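(* Let $Q$ be a weakly connected finite quiver without cycles, and let $\mathfrak{s}_Q$ be the solvable Lie algebra obtained by $Q$. Then there exists an inner product $\langle,\rangle$ on $\mathfrak{s}_Q$ such that $(\mathfrak{s}_Q,\langle,\rangle)$ is an algebraic Ricci soliton.
   Context: A quiver $Q=(V,E,s,t)$ consists of two sets $V$ (vertices), $E$ (arrows) and two maps $s,t:E\to V$ (source and target). It is finite if $V$ and $E$ are finite. For $m\ge 1$, a path of length $m$ from $v\in V$ to $w\in V$ is a sequence $(v|\alpha_1,\dots,\alpha_m|w)$ with $\alpha_i\in E$, $t(\alpha_i)=s(\alpha_{i+1})$ for $i=1,\dots,m-1$, $s(\alpha_1)=v$ and $t(\alpha_m)=w$; it is a cycle if $v=w$. Each vertex $v$ is also regarded as a path $(v||v)$ of length $0$ from $v$ to $v$. "Without cycles" means that there is no path of length $\ge 1$ whose source and target coincide. $Q$ is weakly connected if the simple undirected graph with vertex set $V$ and edge set $\{\{s(e),t(e)\}\mid e\in E\}$ is connected. Let $\mathrm{Path}(Q)_{\ge 0}$ be the set of all paths of length $\ge 0$. The path algebra $\mathfrak{s}_Q$ is the $\mathbb{R}$-vector space with basis $\mathrm{Path}(Q)_{\ge 0}$ and bilinear product given on paths $x=(v|\alpha_1,\dots,\alpha_k|w)$, $y=(v'|\beta_1,\dots,\beta_\ell|w')$ by concatenation: $x\cdot y=(v|\alpha_1,\dots,\alpha_k,\beta_1,\dots,\beta_\ell|w')$ if $w=v'$, and $x\cdot y=0$ otherwise. The Lie algebra $\mathfrak{s}_Q$ is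 this space with the bracket $[x,y]=x\cdot y-y\cdot x$; it is called the solvable Lie algebra obtained by $Q$. A metric Lie algebra $(\mathfrak{g},\langle,\rangle)$ is a Lie algebra with an inner product; let $\mathrm{Ric}:\mathfrak{g}\to\mathfrak{g}$ be its Ricci operator, i.e. the Ricci operator at the identity of the corresponding left-invariant metric on the simply-connected Lie group with Lie algebra $\mathfrak{g}$. It is an algebraic Ricci soliton if there exist $c\in\mathbb{R}$ and a derivation $D$ of $\mathfrak{g}$ with $\mathrm{Ric}=c\cdot\mathrm{id}+D$. *)

theory Defs
  imports Complex_Main "HOL-Library.Poly_Mapping" "Graph_Theory.Graph_Theory"
begin

section \<open>Metric Lie algebras and their Ricci operator\<close>

text \<open>
  Lie algebras live on a linear subspace \<open>g\<close> of an ambient real vector space; the bracket, the inner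
  product and all operators are only constrained on \<open>g\<close>.
\<close>

definition linear_within :: "'a::real_vector set \<Rightarrow> ('a \<Rightarrow> 'b::real_vector) \<Rightarrow> bool" where
  "linear_within g f \<longleftrightarrow>
     (\<forall>x\<in>g. \<forall>y\<in>g. f (x + y) = f x + f y) \<and> (\<forall>c. \<forall>x\<in>g. f (c *\<^sub>R x) = c *\<^sub>R f x)"

definition bilinear_within ::
    "'a::real_vector set \<Rightarrow> ('a \<Rightarrow> 'a \<Rightarrow> 'b::real_vector) \<Rightarrow> bool" where
  "bilinear_within g b \<longleftrightarrow>
     (\<forall>x\<in>g. linear_within g (\<lambda>y. b x y)) \<and> (\<forall>y\<in>g. linear_within g (\<lambda>x. b x y))"

definition inner_product_within ::
    "'a::real_vector set \<Rightarrow> ('a \<Rightarrow> 'a \<Rightarrow> real) \<Rightarrow> bool" where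
  "inner_product_within g ip \<longleftrightarrow> bilinear_within g ip \<and>
     (\<forall>x\<in>g. \<forall>y\<in>g. ip x y = ip y x) \<and> (\<forall>x\<in>g. x \<noteq> 0 \<longrightarrow> ip x x > 0)"

text \<open>The trace of an endomorphism of a finite-dimensional \<open>g\<close>, computed in some basis.\<close>

definition trace_within :: "'a::real_vector set \<Rightarrow> ('a \<Rightarrow> 'a) \<Rightarrow> real" where
  "trace_within g f =
     (let B = (SOME B. independent B \<and> span B = g) in \<Sum>b\<in>B. representation B (f b) b)"

locale lie_algebra_within =
  fixes g :: "'a::real_vector set" and br :: "'a \<Rightarrow> 'a \<Rightarrow> 'a"
  assumes subspace: "subspace g"
    and br_closed: "\<lbrakk>x \<in> g; y \<in> g\<rbrakk> \<Longrightarrow> br x y \<in> g"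
    and br_bilinear: "bilinear_within g br"
    and br_self: "x \<in> g \<Longrightarrow> br x x = 0"
    and jacobi: "\<lbrakk>x \<in> g; y \<in> g; z \<in> g\<rbrakk> \<Longrightarrow>
      br x (br y z) + br y (br z x) + br z (br x y) = 0"
begin

definition derivation :: "('a \<Rightarrow> 'a) \<Rightarrow> bool" where
  "derivation D \<longleftrightarrow> D ` g \<subseteq> g \<and> linear_within g D \<and>
     (\<forall>x\<in>g. \<forall>y\<in>g. D (br x y) = br (D x) y + br x (D y))"

end

locale metric_lie_algebra = lie_algebra_within g br
  for g :: "'a::real_vector set" and br :: "'a \<Rightarrow> 'a \<Rightarrow> 'a" +
  fixes ip :: "'a \<Rightarrow> 'a \<Rightarrow> real"
  assumes finite_dim: "\<exists>B. finite B \<and> span B = g"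
    and inner_product: "inner_product_within g ip"
begin

text \<open>
  Elements of \<open>g\<close> are identified with the left-invariant vector fields on the simply connected Lie
  group, \<open>ip\<close> with the left-invariant metric. For such fields the Levi-Civita connection is again
  left-invariant and is determined by the Koszul formula, in which the derivatives of the (constant)
  inner products vanish.
\<close>

definition levi_civita :: "'a \<Rightarrow> 'a \<Rightarrow> 'a" where
  "levi_civita x y =
     (THE w. w \<in> g \<and> (\<forall>z\<in>g. 2 * ip w z = ip (br x y) z - ip (br y z) x + ip (br z x) y))"

definition curvature :: "'a \<Rightarrow> 'a \<Rightarrow> 'a \<Rightarrow> 'a" where
  "curvature x y z =
     levi_civita x (levi_civita y z) - levi_civita y (levi_civita x z) - levi_civita (br x y) z"

definition ricci_form :: "'a \<Rightarrow> 'a \<Rightarrow> real" where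
  "ricci_form x y = trace_within g (\<lambda>z. curvature z x y)"

definition ricci :: "'a \<Rightarrow> 'a" where
  "ricci x = (THE w. w \<in> g \<and> (\<forall>y\<in>g. ip w y = ricci_form x y))"

end

locale algebraic_ricci_soliton = metric_lie_algebra +
  assumes ricci_soliton: "\<exists>c D. derivation D \<and> (\<forall>x\<in>g. ricci x = c *\<^sub>R x + D x)"

section \<open>Quivers and their path algebras\<close>

text \<open>
  Finite quivers are the finite multi-digraphs \<open>fin_digraph\<close>, with \<open>tail\<close> as source and \<open>head\<close> as
  target. A path is a triple (source, list of arrows, target), so that different vertices give
  different paths of length 0.
\<close>

type_synonym ('v, 'e) qpath = "'v \<times> 'e list \<times> 'v"

definition quiver_paths :: "('v, 'e) pre_digraph \<Rightarrow> ('v, 'e) qpath set" where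
  "quiver_paths Q = {(v, p, w). pre_digraph.awalk Q v p w}"

definition quiver_acyclic :: "('v, 'e) pre_digraph \<Rightarrow> bool" where
  "quiver_acyclic Q \<longleftrightarrow> (\<nexists>v p. (v, p, v) \<in> quiver_paths Q \<and> p \<noteq> [])"

text \<open>
  \<open>Graph_Theory\<close> calls a digraph connected if its underlying symmetric digraph has a vertex and any
  two of its vertices are joined by a path.
\<close>

abbreviation weakly_connected :: "('v, 'e) pre_digraph \<Rightarrow> bool" where
  "weakly_connected \<equiv> Digraph_Component.connected"

instantiation poly_mapping :: (type, real_vector) real_vector
begin

lift_definition scaleR_poly_mapping :: "real \<Rightarrow> ('a \<Rightarrow>\<^sub>0 'b) \<Rightarrow> ('a \<Rightarrow>\<^sub>0 'b)"
  is "\<lambda>c f k. c *\<^sub>R f k"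
proof -
  fix c and f :: "'a \<Rightarrow> 'b"
  assume "finite {k. f k \<noteq> 0}"
  then show "finite {k. c *\<^sub>R f k \<noteq> 0}"
    by (rule rev_finite_subset) auto
qed

instance
  by standard (transfer; simp add: fun_eq_iff scaleR_add_right scaleR_add_left)+

end

text \<open>
  The vector space with basis the paths of \<open>Q\<close>. Concatenation is extended bilinearly to
  all finitely supported families of triples.
\<close>

definition path_algebra :: "('v, 'e) pre_digraph \<Rightarrow> (('v, 'e) qpath \<Rightarrow>\<^sub>0 real) set" where
  "path_algebra Q = {f. Poly_Mapping.keys f \<subseteq> quiver_paths Q}"

fun path_concat :: "('v, 'e) qpath \<Rightarrow> ('v, 'e) qpath \<Rightarrow> (('v, 'e) qpath \<Rightarrow>\<^sub>0 real)" where
  "path_concat (v, p, w) (v', q, w') =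
     (if w = v' then Poly_Mapping.single (v, p @ q, w') 1 else 0)"

definition path_mult ::
    "(('v, 'e) qpath \<Rightarrow>\<^sub>0 real) \<Rightarrow> (('v, 'e) qpath \<Rightarrow>\<^sub>0 real) \<Rightarrow> (('v, 'e) qpath \<Rightarrow>\<^sub>0 real)" where
  "path_mult f h =
     (\<Sum>x\<in>Poly_Mapping.keys f. \<Sum>y\<in>Poly_Mapping.keys h.
        (Poly_Mapping.lookup f x * Poly_Mapping.lookup h y) *\<^sub>R path_concat x y)"

definition path_bracket ::
    "(('v, 'e) qpath \<Rightarrow>\<^sub>0 real) \<Rightarrow> (('v, 'e) qpath \<Rightarrow>\<^sub>0 real) \<Rightarrow> (('v, 'e) qpath \<Rightarrow>\<^sub>0 real)" where
  "path_bracket f h = path_mult f h - path_mult h f"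

end

(*
  The inner product makes the paths of positive length orthogonal to each other and to the vertices.
  A path p of positive length gets squared norm h(p), the product of w(v) = 1/(1 + O(v) + I(v)) over
  its interior vertices v, where O(v) and I(v) count the paths of positive length leaving and entering
  v.  By acyclicity all mixed terms in the Ricci form vanish, so each p is an eigenvector; since
  h(kl) = h(k) w(v) h(l) for composable k, l meeting in v, its eigenvalue is
    (sum of w over the interior - w(t) O(t) - w(s) I(s)) / 2 - (weight of p at the mean curvature vector)
  with s, t the source and target of p; the weight of p at x, by which the vertex combination x acts on
  p, is x(s) - x(t).  The relation w(v) (1 + O(v) + I(v)) = 1 says that this
  eigenvalue plus 1/2 is additive under concatenation, hence defines a derivation.  On the vertices the
  Ricci form is minus the sum of the products of the weights of the paths, which is -1/2 times the
  inner product up to a correction by a derivation with central image.  Hence Ric = -1/2 id + D.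
*)

theory Submission
  imports Defs
begin

section \<open>Inner products on a subspace\<close>

text \<open>A diagonal map on paths is a derivation once its eigenvalues add up under concatenation,
  so it is enough to choose the squared norm h such that paths are Ricci eigenvectors with suitable
  eigenvalues. Making h a product over interior vertices decouples this: comparing the eigenvalue of
  kl with those of k and l leaves only w(v) (1 + O(v) + I(v)) / 2 at the meeting vertex v, so each
  w(v) solves a scalar equation of its own. The constant -1/2 is a normalisation; with c in its
  place the equation would read w(v) (1 + O(v) + I(v)) = -2 c. Such a diagonal derivation vanishes
  on the vertices, so there Ric itself must be -1/2 modulo the center, which dictates twice the sum
  of the products of weights as inner product. This form is degenerate: the sum of all vertices is
  central and every weight vanishes on it. Hence the extra summand in the inner product, and the
  correction term, which is a derivation because it kills commutators and maps into the
  center.\<close>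

lemma linear_within_sum_scaleR:
  assumes "linear_within g f" "subspace g" "\<And>i. i \<in> I \<Longrightarrow> u i \<in> g"
  shows "f (\<Sum>i\<in>I. c i *\<^sub>R u i) = (\<Sum>i\<in>I. c i *\<^sub>R f (u i))"
proof (cases "finite I")
  case True
  then show ?thesis using assms(3)
  proof (induction I rule: finite_induct)
    case empty
    have "f (0 *\<^sub>R 0) = 0 *\<^sub>R f 0"
      using assms(1,2) subspace_0 unfolding linear_within_def by blast
    then show ?case by simp
  next
    case (insert i I)
    have "(\<Sum>i\<in>I. c i *\<^sub>R u i) \<in> g" "u i \<in> g" "c i *\<^sub>R u i \<in> g"
      using insert assms(2) by (auto intro!: subspace_sum subspace_scale)
    then show ?case
      using insert assms(1) unfolding linear_within_def by simp
  qed
next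
  \<comment> \<open>A sum over an infinite set is 0 by convention, so what remains is
    \<open>f 0 = 0\<close>, which homogeneity gives.\<close>
  case False
  have "f (0 *\<^sub>R 0) = 0 *\<^sub>R f 0"
    using assms(1,2) subspace_0 unfolding linear_within_def by blast
  with False show ?thesis by simp
qed

text \<open>Strengthens \<open>span_induct_alt\<close>: the step may assume that \<open>y\<close>
  lies in the span, which is where the maps under consideration are constrained at all.\<close>

lemma span_induct_within [consumes 1, case_names base step]:
  assumes "x \<in> span B" "P 0"
    and "\<And>c b y. b \<in> B \<Longrightarrow> y \<in> span B \<Longrightarrow> P y \<Longrightarrow> P (c *\<^sub>R b + y)"
  shows "P x"
proof -
  have "x \<in> span B \<and> P x"
    using assms(1)
    by (induction rule: span_induct_alt) (auto intro: assms(2,3) span_zero span_add span_scale span_base)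
  then show ?thesis ..
qed

lemma linear_within_eq_on_span:
  assumes "linear_within (span B) f" "linear_within (span B) h" "\<And>b. b \<in> B \<Longrightarrow> f b = h b" "x \<in> span B"
  shows "f x = h x"
  using assms(4)
proof (induction rule: span_induct_within)
  case base
  have "f (0 *\<^sub>R 0) = 0 *\<^sub>R f 0" "h (0 *\<^sub>R 0) = 0 *\<^sub>R h 0"
    using assms(1,2) span_0 unfolding linear_within_def by blast+
  then show ?case by simp
next
  case (step c b y)
  then show ?case
    using assms(1,2) assms(3)[OF step(1)] span_base[of b B] span_scale[of b B c]
    unfolding linear_within_def by simp
qed

locale inner_product_on =
  fixes g :: "'a::real_vector set" and ip :: "'a \<Rightarrow> 'a \<Rightarrow> real"
  assumes subspace_carrier: "subspace g" and ip_on: "inner_product_within g ip"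
begin

lemma
  ip_commute: "x \<in> g \<Longrightarrow> y \<in> g \<Longrightarrow> ip x y = ip y x" and
  ip_pos: "x \<in> g \<Longrightarrow> x \<noteq> 0 \<Longrightarrow> ip x x > 0" and
  linear_ip_right: "x \<in> g \<Longrightarrow> linear_within g (\<lambda>y. ip x y)" and
  linear_ip_left: "y \<in> g \<Longrightarrow> linear_within g (\<lambda>x. ip x y)"
  using ip_on unfolding inner_product_within_def bilinear_within_def by auto

lemma
  ip_add_left: "x \<in> g \<Longrightarrow> y \<in> g \<Longrightarrow> z \<in> g \<Longrightarrow> ip (x + y) z = ip x z + ip y z" and
  ip_add_right: "x \<in> g \<Longrightarrow> y \<in> g \<Longrightarrow> z \<in> g \<Longrightarrow> ip z (x + y) = ip z x + ip z y" and
  ip_scale_left: "x \<in> g \<Longrightarrow> z \<in> g \<Longrightarrow> ip (c *\<^sub>R x) z = c * ip x z" and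
  ip_scale_right: "x \<in> g \<Longrightarrow> z \<in> g \<Longrightarrow> ip z (c *\<^sub>R x) = c * ip z x"
  using linear_ip_right[of z] linear_ip_left[of z] unfolding linear_within_def by auto

lemma ip_minus_left: "x \<in> g \<Longrightarrow> z \<in> g \<Longrightarrow> ip (- x) z = - ip x z"
  using ip_scale_left[of x z "-1"] by simp

lemma ip_minus_right: "x \<in> g \<Longrightarrow> z \<in> g \<Longrightarrow> ip z (- x) = - ip z x"
  using ip_scale_right[of x z "-1"] by simp

lemma ip_diff_left: "x \<in> g \<Longrightarrow> y \<in> g \<Longrightarrow> z \<in> g \<Longrightarrow> ip (x - y) z = ip x z - ip y z"
  using ip_add_left[of x "- y" z] ip_minus_left[of y z] subspace_neg[OF subspace_carrier] by simp

lemma ip_zero [simp]: "x \<in> g \<Longrightarrow> ip 0 x = 0" "x \<in> g \<Longrightarrow> ip x 0 = 0"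
  using ip_scale_left[of x x 0] ip_scale_right[of x x 0] by auto

lemma ip_sum_left:
  assumes "\<And>i. i \<in> I \<Longrightarrow> u i \<in> g" "z \<in> g"
  shows "ip (\<Sum>i\<in>I. c i *\<^sub>R u i) z = (\<Sum>i\<in>I. c i * ip (u i) z)"
  using linear_within_sum_scaleR[OF linear_ip_left subspace_carrier, of z I u c] assms by simp

text \<open>Pairing \<open>x - y\<close> with itself contradicts definiteness. This is the
  uniqueness half of the definite descriptions \<open>levi_civita\<close> and
  \<open>ricci\<close>.\<close>

lemma eq_if_ip_eq:
  assumes "x \<in> g" "y \<in> g" "\<And>z. z \<in> g \<Longrightarrow> ip x z = ip y z"
  shows "x = y"
proof (rule ccontr)
  assume "x \<noteq> y"
  moreover have "x - y \<in> g" using assms subspace_diff[OF subspace_carrier] by auto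
  ultimately have "ip (x - y) (x - y) > 0" using ip_pos by auto
  then show False using assms ip_diff_left[of x y "x - y"] \<open>x - y \<in> g\<close> by simp
qed

definition orthonormal :: "'a set \<Rightarrow> bool" where
  "orthonormal E \<longleftrightarrow> finite E \<and> E \<subseteq> g \<and> (\<forall>e\<in>E. \<forall>f\<in>E. ip e f = (if e = f then 1 else 0))"

lemma orthonormal_expansion:
  assumes "orthonormal E" "x \<in> span E"
  shows "x = (\<Sum>e\<in>E. ip x e *\<^sub>R e)"
  using assms(2)
proof (induction rule: span_induct_within)
  case base
  then show ?case using assms(1) by (auto simp: orthonormal_def subset_iff intro!: sum.neutral[symmetric])
next
  case (step c b y)
  have E: "finite E" "E \<subseteq> g" "\<And>e f. e \<in> E \<Longrightarrow> f \<in> E \<Longrightarrow> ip e f = (if e = f then 1 else 0)"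
    using assms(1) by (auto simp: orthonormal_def)
  have y: "y \<in> g" using step(2) E(2) subspace_carrier span_minimal by blast
  have b: "b \<in> g" "c *\<^sub>R b \<in> g"
    using step(1) E(2) subspace_scale[OF subspace_carrier] by auto
  have "(\<Sum>e\<in>E. ip (c *\<^sub>R b + y) e *\<^sub>R e)
      = (\<Sum>e\<in>E. (if b = e then c *\<^sub>R e else 0)) + (\<Sum>e\<in>E. ip y e *\<^sub>R e)"
    unfolding sum.distrib[symmetric]
  proof (rule sum.cong[OF refl])
    fix e assume e: "e \<in> E"
    then show "ip (c *\<^sub>R b + y) e *\<^sub>R e = (if b = e then c *\<^sub>R e else 0) + ip y e *\<^sub>R e"
      using E b y step(1) by (auto simp: ip_add_left ip_scale_left subset_iff scaleR_add_left)
  qed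
  also have "\<dots> = c *\<^sub>R b + y" using step E(1) by (simp add: sum.delta)
  finally show ?case ..
qed

text \<open>Only the span is preserved through the induction: a vector with zero residual is dropped
  and the current family is kept.\<close>

lemma gram_schmidt:
  assumes "finite B" "B \<subseteq> g"
  shows "\<exists>E. orthonormal E \<and> span E = span B"
  using assms
proof (induction B rule: finite_induct)
  case empty
  have "orthonormal {}" by (simp add: orthonormal_def)
  then show ?case by blast
next
  case (insert b B)
  then obtain E where E: "orthonormal E" "span E = span B" by auto
  have E': "finite E" "E \<subseteq> g" "\<And>e f. e \<in> E \<Longrightarrow> f \<in> E \<Longrightarrow> ip e f = (if e = f then 1 else 0)"
    using E(1) by (auto simp: orthonormal_def)
  have b: "b \<in> g" using insert by auto
  \<comment> \<open>The orthogonal projection of \<open>b\<close> onto the span of \<open>E\<close>;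
    the residual \<open>b - p\<close> is what gets normalised below.\<close>
  define p where "p = (\<Sum>e\<in>E. ip b e *\<^sub>R e)"
  have p_span: "p \<in> span E" unfolding p_def by (intro span_sum span_scale span_base)
  have p: "p \<in> g" using p_span E'(2) subspace_carrier span_minimal by blast
  have bp: "b - p \<in> g" using b p subspace_diff[OF subspace_carrier] by auto
  have orth: "ip (b - p) e = 0" if "e \<in> E" for e
  proof -
    have "ip p e = (\<Sum>f\<in>E. ip b f * ip f e)"
      unfolding p_def using that E'(2) by (intro ip_sum_left) auto
    also have "\<dots> = (\<Sum>f\<in>E. if f = e then ip b f else 0)"
      using that E'(3) by (intro sum.cong) auto
    also have "\<dots> = ip b e" using that E'(1) by (simp add: sum.delta)
    finally show ?thesis using b p that E'(2) by (simp add: ip_diff_left subset_iff)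
  qed
  have spans: "span (insert b B) = span (insert (b - p) E)"
  proof -
    have "span (insert b B) = span (insert b E)"
      using E(2) by (simp add: span_insert)
    also have "\<dots> = span (insert (b - p) E)"
    proof (rule span_eq[THEN iffD2], intro conjI subsetI)
      fix x assume "x \<in> insert b E"
      moreover have "b \<in> span (insert (b - p) E)"
        using span_add[OF span_base[of "b - p" "insert (b - p) E"] subsetD[OF span_mono p_span, of "insert (b-p) E"]]
        by auto
      ultimately show "x \<in> span (insert (b - p) E)" by (auto intro: span_base)
    next
      fix x assume "x \<in> insert (b - p) E"
      moreover have "b - p \<in> span (insert b E)"
        using span_diff[OF span_base[of b "insert b E"] subsetD[OF span_mono p_span, of "insert b E"]]
        by auto
      ultimately show "x \<in> span (insert b E)" by (auto intro: span_base)
    qed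
    finally show ?thesis .
  qed
  show ?case
  proof (cases "b - p = 0")
    case True
    then have "span (insert b B) = span E" using spans by (simp add: span_insert_0)
    then show ?thesis using E by auto
  next
    case False
    define n where "n = (1 / sqrt (ip (b - p) (b - p))) *\<^sub>R (b - p)"
    have pos: "ip (b - p) (b - p) > 0" using False bp ip_pos by blast
    have n: "n \<in> g" unfolding n_def using bp subspace_scale[OF subspace_carrier] by auto
    have nn: "ip n n = 1"
      unfolding n_def using bp pos subspace_scale[OF subspace_carrier]
      by (simp add: ip_scale_left ip_scale_right flip: power2_eq_square)
    have ne: "ip n e = 0" "ip e n = 0" if "e \<in> E" for e
      using orth[OF that] bp n that E'(2) ip_commute[of e n]
      unfolding n_def by (auto simp: ip_scale_left subset_iff)
    have "n \<notin> E" using ne nn by force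
    then have "orthonormal (insert n E)"
      unfolding orthonormal_def using E'(1,2) n E'(3) nn ne \<open>n \<notin> E\<close> by auto
    moreover have "span (insert n E) = span (insert (b - p) E)"
    proof (rule span_eq[THEN iffD2], intro conjI subsetI)
      fix x assume "x \<in> insert n E"
      then show "x \<in> span (insert (b - p) E)"
        unfolding n_def by (auto intro: span_base span_scale)
    next
      fix x assume x: "x \<in> insert (b - p) E"
      have "b - p = sqrt (ip (b - p) (b - p)) *\<^sub>R n" using pos by (simp add: n_def)
      then have "b - p \<in> span (insert n E)" by (metis insertI1 span_base span_scale)
      with x show "x \<in> span (insert n E)" by (auto intro: span_base)
    qed
    ultimately show ?thesis using spans by metis
  qed
qed

text \<open>\<open>trace_within\<close> is computed in an unspecified basis \<open>B\<close>.
  Expanding each \<open>b\<close> in \<open>E\<close> and each \<open>f e\<close> in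
  \<open>B\<close>, then swapping the two sums, moves the trace to the orthonormal basis.\<close>

lemma trace_within_orthonormal:
  assumes E: "orthonormal E" "span E = g" and f: "linear_within g f" "f ` g \<subseteq> g"
  shows "trace_within g f = (\<Sum>e\<in>E. ip (f e) e)"
proof -
  have E': "finite E" "E \<subseteq> g"
    using E(1) by (auto simp: orthonormal_def)
  define B where "B = (SOME B. independent B \<and> span B = g)"
  have "\<exists>B. independent B \<and> span B = g"
    using basis_exists[of g] by (metis span_subspace subspace_carrier)
  then have B: "independent B" "span B = g"
    unfolding B_def by (metis (mono_tags, lifting) someI_ex)+
  have fin: "finite B"
    using independent_span_bound[OF E'(1) B(1)] B(2) E(2) span_superset[of B] by auto
  have Bg: "B \<subseteq> g" using B(2) span_superset by auto
  have fb: "representation B (f b) b = (\<Sum>e\<in>E. ip b e * representation B (f e) b)" if "b \<in> B" for b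
  proof -
    have "b = (\<Sum>e\<in>E. ip b e *\<^sub>R e)"
      using orthonormal_expansion[OF E(1), of b] E(2) Bg that by auto
    then have "f b = (\<Sum>e\<in>E. ip b e *\<^sub>R f e)"
      using linear_within_sum_scaleR[OF f(1) subspace_carrier, of E "\<lambda>e. e" "ip b"] E'(2) by auto
    moreover have "f e \<in> span B" if "e \<in> E" for e using that f(2) E'(2) B(2) by auto
    ultimately show ?thesis
      using B(1) by (simp add: representation_sum representation_scale span_scale)
  qed
  have fe: "(\<Sum>b\<in>B. representation B (f e) b * ip b e) = ip (f e) e" if "e \<in> E" for e
  proof -
    have "(\<Sum>b\<in>B. representation B (f e) b *\<^sub>R b) = f e"
      using sum_representation_eq[OF B(1) _ fin order_refl] f(2) E'(2) B(2) that by auto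
    then show ?thesis
      using ip_sum_left[of B "\<lambda>b. b" e "representation B (f e)"] Bg that E'(2)
      by (simp add: subset_iff)
  qed
  have "trace_within g f = (\<Sum>b\<in>B. representation B (f b) b)"
    unfolding trace_within_def B_def[symmetric] by simp
  also have "\<dots> = (\<Sum>b\<in>B. \<Sum>e\<in>E. ip b e * representation B (f e) b)"
    using fb by simp
  also have "\<dots> = (\<Sum>e\<in>E. \<Sum>b\<in>B. representation B (f e) b * ip b e)"
    by (subst sum.swap) (simp add: mult.commute)
  also have "\<dots> = (\<Sum>e\<in>E. ip (f e) e)" using fe by simp
  finally show ?thesis .
qed

end

section \<open>The Ricci form in terms of the bracket\<close>

context lie_algebra_within
begin

lemma
  linear_br_right: "x \<in> g \<Longrightarrow> linear_within g (\<lambda>y. br x y)" and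
  linear_br_left: "y \<in> g \<Longrightarrow> linear_within g (\<lambda>x. br x y)"
  using br_bilinear unfolding bilinear_within_def by auto

lemma
  br_add_left: "x \<in> g \<Longrightarrow> y \<in> g \<Longrightarrow> z \<in> g \<Longrightarrow> br (x + y) z = br x z + br y z" and
  br_add_right: "x \<in> g \<Longrightarrow> y \<in> g \<Longrightarrow> z \<in> g \<Longrightarrow> br z (x + y) = br z x + br z y" and
  br_scale_left: "x \<in> g \<Longrightarrow> z \<in> g \<Longrightarrow> br (c *\<^sub>R x) z = c *\<^sub>R br x z" and
  br_scale_right: "x \<in> g \<Longrightarrow> z \<in> g \<Longrightarrow> br z (c *\<^sub>R x) = c *\<^sub>R br z x"
  using linear_br_right[of z] linear_br_left[of z] unfolding linear_within_def by auto

lemma br_anticommute: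
  assumes "x \<in> g" "y \<in> g"
  shows "br x y = - br y x"
proof -
  have "br (x + y) (x + y) = 0" using assms subspace_add[OF subspace] by (intro br_self) auto
  then have "br x x + br x y + (br y x + br y y) = 0"
    using assms subspace_add[OF subspace] by (simp add: br_add_left br_add_right add_ac)
  then show ?thesis using assms by (simp add: br_self eq_neg_iff_add_eq_0)
qed

end

sublocale metric_lie_algebra \<subseteq> inner_product_on g ip
  using subspace inner_product by unfold_locales

context metric_lie_algebra
begin

lemma ex_orthonormal_basis: "\<exists>E. orthonormal E \<and> span E = g"
  using finite_dim gram_schmidt span_superset by metis

text \<open>Riesz representation, with the values of the functional on an orthonormal basis as
  coordinates. It supplies the existence of \<open>levi_civita\<close> and of the mean curvature
  vector.\<close>

lemma ip_representation:
  assumes "linear_within g \<phi>"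
  shows "\<exists>w\<in>g. \<forall>z\<in>g. ip w z = (\<phi> z :: real)"
proof -
  obtain E where E: "orthonormal E" "span E = g" using ex_orthonormal_basis by blast
  have Eg: "E \<subseteq> g" using E by (auto simp: orthonormal_def)
  define w where "w = (\<Sum>e\<in>E. \<phi> e *\<^sub>R e)"
  have "w \<in> g" unfolding w_def E(2)[symmetric] by (intro span_sum span_scale span_base)
  moreover have "ip w z = \<phi> z" if "z \<in> g" for z
  proof -
    have "ip w z = (\<Sum>e\<in>E. \<phi> e * ip e z)"
      unfolding w_def using Eg that by (intro ip_sum_left) auto
    also have "\<dots> = (\<Sum>e\<in>E. ip z e * \<phi> e)"
      using Eg that ip_commute by (intro sum.cong) (auto simp: mult.commute subset_iff)
    also have "\<dots> = \<phi> (\<Sum>e\<in>E. ip z e *\<^sub>R e)"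
      using linear_within_sum_scaleR[OF assms subspace, of E "\<lambda>e. e" "ip z"] Eg by (simp add: subset_iff)
    also have "\<dots> = \<phi> z" using orthonormal_expansion[OF E(1), of z] that E(2) by simp
    finally show ?thesis .
  qed
  ultimately show ?thesis by blast
qed

text \<open>The right-hand side of the Koszul formula is linear in \<open>z\<close>, so it is
  represented by a vector, and definiteness makes this vector unique; hence the definite description
  denotes.\<close>

lemma
  assumes "x \<in> g" "y \<in> g"
  shows levi_civita_closed: "levi_civita x y \<in> g"
    and koszul: "z \<in> g \<Longrightarrow> ip (levi_civita x y) z =
      (ip (br x y) z - ip (br y z) x + ip (br z x) y) / 2"
proof -
  let ?\<phi> = "\<lambda>z. (ip (br x y) z - ip (br y z) x + ip (br z x) y) / 2"
  have "linear_within g ?\<phi>"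
    unfolding linear_within_def using assms
    by (auto simp: br_add_left br_add_right br_scale_left br_scale_right ip_add_left ip_add_right
        ip_scale_left ip_scale_right br_closed field_simps)
  then obtain w where w: "w \<in> g" "\<And>z. z \<in> g \<Longrightarrow> ip w z = ?\<phi> z"
    using ip_representation by blast
  have "levi_civita x y = w"
    unfolding levi_civita_def
  proof (rule the_equality)
    show "w \<in> g \<and> (\<forall>z\<in>g. 2 * ip w z = ip (br x y) z - ip (br y z) x + ip (br z x) y)"
      using w by (simp add: w(2))
    fix u assume u: "u \<in> g \<and> (\<forall>z\<in>g. 2 * ip u z = ip (br x y) z - ip (br y z) x + ip (br z x) y)"
    show "u = w"
    proof (rule eq_if_ip_eq)
      fix z assume "z \<in> g"
      then have "2 * ip u z = 2 * ip w z" using u w(2)[of z] by simp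
      then show "ip u z = ip w z" by simp
    qed (use u w in auto)
  qed
  with w show "levi_civita x y \<in> g"
    "z \<in> g \<Longrightarrow> ip (levi_civita x y) z = (ip (br x y) z - ip (br y z) x + ip (br z x) y) / 2"
    by auto
qed

text \<open>Metric compatibility: inner products of left-invariant fields are constant, so covariant
  differentiation along \<open>x\<close> is skew-adjoint.\<close>

lemma levi_civita_skew:
  assumes "x \<in> g" "y \<in> g" "z \<in> g"
  shows "ip (levi_civita x y) z = - ip y (levi_civita x z)"
proof -
  have "ip y (levi_civita x z) = ip (levi_civita x z) y"
    using assms levi_civita_closed ip_commute by blast
  moreover have "ip (br z y) x = - ip (br y z) x"
    using assms br_anticommute[of z y] by (simp add: ip_minus_left br_closed)
  moreover have "ip (br y x) z = - ip (br x y) z" "ip (br z x) y = - ip (br x z) y"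
    using assms br_anticommute[of y x] br_anticommute[of z x] by (simp_all add: ip_minus_left br_closed)
  ultimately show ?thesis using assms by (simp add: koszul)
qed

section \<open>Multilinearity of the connection, the curvature and the Ricci form\<close>

lemma levi_civita_add_left:
  assumes "x \<in> g" "x' \<in> g" "y \<in> g"
  shows "levi_civita (x + x') y = levi_civita x y + levi_civita x' y"
  using assms subspace_add[OF subspace] levi_civita_closed
  by (intro eq_if_ip_eq)
     (auto simp: koszul ip_add_left ip_add_right br_add_left br_add_right br_closed field_simps)

lemma levi_civita_add_right:
  assumes "x \<in> g" "x' \<in> g" "y \<in> g"
  shows "levi_civita y (x + x') = levi_civita y x + levi_civita y x'"
  using assms subspace_add[OF subspace] levi_civita_closed
  by (intro eq_if_ip_eq)
     (auto simp: koszul ip_add_left ip_add_right br_add_left br_add_right br_closed field_simps)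

lemma levi_civita_scale_left:
  assumes "x \<in> g" "y \<in> g"
  shows "levi_civita (c *\<^sub>R x) y = c *\<^sub>R levi_civita x y"
  using assms subspace_scale[OF subspace] levi_civita_closed
  by (intro eq_if_ip_eq)
     (auto simp: koszul ip_scale_left ip_scale_right br_scale_left br_scale_right br_closed field_simps)

lemma levi_civita_scale_right:
  assumes "x \<in> g" "y \<in> g"
  shows "levi_civita y (c *\<^sub>R x) = c *\<^sub>R levi_civita y x"
  using assms subspace_scale[OF subspace] levi_civita_closed
  by (intro eq_if_ip_eq)
     (auto simp: koszul ip_scale_left ip_scale_right br_scale_left br_scale_right br_closed field_simps)

lemma curvature_closed: "x \<in> g \<Longrightarrow> y \<in> g \<Longrightarrow> z \<in> g \<Longrightarrow> curvature x y z \<in> g"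
  unfolding curvature_def
  by (intro subspace_diff[OF subspace] levi_civita_closed br_closed)

lemma curvature_linear:
  assumes "x \<in> g" "y \<in> g"
  shows "linear_within g (\<lambda>z. curvature z x y)"
  unfolding linear_within_def
proof (intro conjI ballI allI)
  note closed = levi_civita_closed br_closed assms
  fix z z' assume z: "z \<in> g" "z' \<in> g"
  have "levi_civita (z + z') (levi_civita x y) = levi_civita z (levi_civita x y) + levi_civita z' (levi_civita x y)"
    "levi_civita x (levi_civita (z + z') y) = levi_civita x (levi_civita z y) + levi_civita x (levi_civita z' y)"
    "levi_civita (br (z + z') x) y = levi_civita (br z x) y + levi_civita (br z' x) y"
    using z by (simp_all add: levi_civita_add_left levi_civita_add_right br_add_left closed)
  then show "curvature (z + z') x y = curvature z x y + curvature z' x y"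
    by (simp add: curvature_def)
next
  note closed = levi_civita_closed br_closed assms
  fix c z assume z: "z \<in> g"
  have "levi_civita (c *\<^sub>R z) (levi_civita x y) = c *\<^sub>R levi_civita z (levi_civita x y)"
    "levi_civita x (levi_civita (c *\<^sub>R z) y) = c *\<^sub>R levi_civita x (levi_civita z y)"
    "levi_civita (br (c *\<^sub>R z) x) y = c *\<^sub>R levi_civita (br z x) y"
    using z by (simp_all add: levi_civita_scale_left levi_civita_scale_right br_scale_left closed)
  then show "curvature (c *\<^sub>R z) x y = c *\<^sub>R curvature z x y"
    by (simp add: curvature_def scaleR_diff_right)
qed

lemma ricci_form_orthonormal:
  assumes "orthonormal E" "span E = g" "x \<in> g" "y \<in> g"
  shows "ricci_form x y = (\<Sum>e\<in>E. ip (curvature e x y) e)"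
  unfolding ricci_form_def
  using assms curvature_linear curvature_closed by (intro trace_within_orthonormal) auto

lemma curvature_linear_middle:
  assumes "z \<in> g" "y \<in> g"
  shows "linear_within g (\<lambda>x. curvature z x y)"
  unfolding linear_within_def
proof (intro conjI ballI allI)
  note closed = levi_civita_closed br_closed assms
  fix x x' assume x: "x \<in> g" "x' \<in> g"
  have "levi_civita z (levi_civita (x + x') y) = levi_civita z (levi_civita x y) + levi_civita z (levi_civita x' y)"
    "levi_civita (x + x') (levi_civita z y) = levi_civita x (levi_civita z y) + levi_civita x' (levi_civita z y)"
    "levi_civita (br z (x + x')) y = levi_civita (br z x) y + levi_civita (br z x') y"
    using x by (simp_all add: levi_civita_add_left levi_civita_add_right br_add_right closed)
  then show "curvature z (x + x') y = curvature z x y + curvature z x' y"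
    by (simp add: curvature_def)
next
  note closed = levi_civita_closed br_closed assms
  fix c x assume x: "x \<in> g"
  have "levi_civita z (levi_civita (c *\<^sub>R x) y) = c *\<^sub>R levi_civita z (levi_civita x y)"
    "levi_civita (c *\<^sub>R x) (levi_civita z y) = c *\<^sub>R levi_civita x (levi_civita z y)"
    "levi_civita (br z (c *\<^sub>R x)) y = c *\<^sub>R levi_civita (br z x) y"
    using x by (simp_all add: levi_civita_scale_left levi_civita_scale_right br_scale_right closed)
  then show "curvature z (c *\<^sub>R x) y = c *\<^sub>R curvature z x y"
    by (simp add: curvature_def scaleR_diff_right)
qed

lemma curvature_linear_right:
  assumes "z \<in> g" "x \<in> g"
  shows "linear_within g (\<lambda>y. curvature z x y)"
  unfolding linear_within_def
proof (intro conjI ballI allI)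
  note closed = levi_civita_closed br_closed assms
  fix y y' assume y: "y \<in> g" "y' \<in> g"
  have "levi_civita z (levi_civita x (y + y')) = levi_civita z (levi_civita x y) + levi_civita z (levi_civita x y')"
    "levi_civita x (levi_civita z (y + y')) = levi_civita x (levi_civita z y) + levi_civita x (levi_civita z y')"
    "levi_civita (br z x) (y + y') = levi_civita (br z x) y + levi_civita (br z x) y'"
    using y by (simp_all add: levi_civita_add_right closed)
  then show "curvature z x (y + y') = curvature z x y + curvature z x y'"
    by (simp add: curvature_def)
next
  note closed = levi_civita_closed br_closed assms
  fix c y assume y: "y \<in> g"
  have "levi_civita z (levi_civita x (c *\<^sub>R y)) = c *\<^sub>R levi_civita z (levi_civita x y)"
    "levi_civita x (levi_civita z (c *\<^sub>R y)) = c *\<^sub>R levi_civita x (levi_civita z y)"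
    "levi_civita (br z x) (c *\<^sub>R y) = c *\<^sub>R levi_civita (br z x) y"
    using y by (simp_all add: levi_civita_scale_right closed)
  then show "curvature z x (c *\<^sub>R y) = c *\<^sub>R curvature z x y"
    by (simp add: curvature_def scaleR_diff_right)
qed

text \<open>Allows the Ricci form to be evaluated on pairs of paths only and then extended to the
  whole path algebra.\<close>

lemma bilinear_ricci_form: "bilinear_within g ricci_form"
proof -
  obtain E where E: "orthonormal E" "span E = g" using ex_orthonormal_basis by blast
  have Eg: "e \<in> g" if "e \<in> E" for e using E(1) that by (auto simp: orthonormal_def)
  have 1: "linear_within g (\<lambda>y. ricci_form x y)" if x: "x \<in> g" for x
    unfolding linear_within_def
  proof (intro conjI ballI allI)
    fix y y' assume y: "y \<in> g" "y' \<in> g"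
    have "ip (curvature e x (y + y')) e = ip (curvature e x y) e + ip (curvature e x y') e" if "e \<in> E" for e
      using curvature_linear_right[OF Eg[OF that] x] y Eg[OF that] x curvature_closed
      by (simp add: linear_within_def ip_add_left)
    then show "ricci_form x (y + y') = ricci_form x y + ricci_form x y'"
      using x y by (simp add: ricci_form_orthonormal[OF E] subspace_add[OF subspace] sum.distrib)
  next
    fix c y assume y: "y \<in> g"
    have "ip (curvature e x (c *\<^sub>R y)) e = c * ip (curvature e x y) e" if "e \<in> E" for e
      using curvature_linear_right[OF Eg[OF that] x] y Eg[OF that] x curvature_closed
      by (simp add: linear_within_def ip_scale_left)
    then show "ricci_form x (c *\<^sub>R y) = c *\<^sub>R ricci_form x y"
      using x y by (simp add: ricci_form_orthonormal[OF E] subspace_scale[OF subspace] sum_distrib_left)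
  qed
  have 2: "linear_within g (\<lambda>x. ricci_form x y)" if y: "y \<in> g" for y
    unfolding linear_within_def
  proof (intro conjI ballI allI)
    fix x x' assume x: "x \<in> g" "x' \<in> g"
    have "ip (curvature e (x + x') y) e = ip (curvature e x y) e + ip (curvature e x' y) e" if "e \<in> E" for e
      using curvature_linear_middle[OF Eg[OF that] y] y Eg[OF that] x curvature_closed
      by (simp add: linear_within_def ip_add_left)
    then show "ricci_form (x + x') y = ricci_form x y + ricci_form x' y"
      using x y by (simp add: ricci_form_orthonormal[OF E] subspace_add[OF subspace] sum.distrib)
  next
    fix c x assume x: "x \<in> g"
    have "ip (curvature e (c *\<^sub>R x) y) e = c * ip (curvature e x y) e" if "e \<in> E" for e
      using curvature_linear_middle[OF Eg[OF that] y] y Eg[OF that] x curvature_closed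
      by (simp add: linear_within_def ip_scale_left)
    then show "ricci_form (c *\<^sub>R x) y = c *\<^sub>R ricci_form x y"
      using x y by (simp add: ricci_form_orthonormal[OF E] subspace_scale[OF subspace] sum_distrib_left)
  qed
  show ?thesis unfolding bilinear_within_def using 1 2 by blast
qed

lemma ricci_eqI:
  assumes "w \<in> g" "\<And>y. y \<in> g \<Longrightarrow> ricci_form x y = ip w y"
  shows "ricci x = w"
  unfolding ricci_def
proof (rule the_equality)
  fix u assume "u \<in> g \<and> (\<forall>y\<in>g. ip u y = ricci_form x y)"
  then show "u = w" using assms by (intro eq_if_ip_eq) auto
qed (use assms in auto)

section \<open>Traces and the Ricci form in a fixed orthonormal basis\<close>

context
  fixes E assumes E: "orthonormal E" "span E = g"
begin

lemma orthonormal_basis_mem: "e \<in> E \<Longrightarrow> e \<in> g"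
  using E by (auto simp: orthonormal_def)

lemma expand: "x \<in> g \<Longrightarrow> x = (\<Sum>e\<in>E. ip x e *\<^sub>R e)"
  using orthonormal_expansion[OF E(1), of x] E(2) by simp

lemma parseval:
  assumes "x \<in> g" "y \<in> g"
  shows "ip x y = (\<Sum>e\<in>E. ip x e * ip y e)"
proof -
  have "ip x y = ip (\<Sum>e\<in>E. ip x e *\<^sub>R e) y" using expand[of x] assms by simp
  also have "\<dots> = (\<Sum>e\<in>E. ip x e * ip e y)"
    using assms orthonormal_basis_mem by (intro ip_sum_left) auto
  also have "\<dots> = (\<Sum>e\<in>E. ip x e * ip y e)"
    using assms orthonormal_basis_mem ip_commute[of _ y] by (intro sum.cong) auto
  finally show ?thesis .
qed

lemma ip_linear_expand:
  assumes "linear_within g f" "f ` g \<subseteq> g" "x \<in> g" "y \<in> g"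
  shows "ip (f x) y = (\<Sum>e\<in>E. ip x e * ip (f e) y)"
proof -
  have "f x = f (\<Sum>e\<in>E. ip x e *\<^sub>R e)" using expand[of x] assms by simp
  also have "\<dots> = (\<Sum>e\<in>E. ip x e *\<^sub>R f e)"
    using linear_within_sum_scaleR[OF assms(1) subspace, of E "\<lambda>e. e" "ip x"] orthonormal_basis_mem
    by simp
  finally show ?thesis
    using ip_sum_left[of E f y "ip x"] assms orthonormal_basis_mem by (simp add: image_subset_iff)
qed

lemma br_image: "x \<in> g \<Longrightarrow> br x ` g \<subseteq> g"
  using br_closed by auto

lemma trace_compose_commute:
  assumes "linear_within g f" "f ` g \<subseteq> g" "linear_within g h" "h ` g \<subseteq> g"
  shows "(\<Sum>e\<in>E. ip (f (h e)) e) = (\<Sum>e\<in>E. ip (h (f e)) e)"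
proof -
  have eg: "f e \<in> g" "h e \<in> g" if "e \<in> E" for e
    using assms(2,4) orthonormal_basis_mem[OF that] by auto
  have "(\<Sum>e\<in>E. ip (f (h e)) e) = (\<Sum>e\<in>E. \<Sum>e'\<in>E. ip (h e) e' * ip (f e') e)"
    using ip_linear_expand[OF assms(1,2)] eg orthonormal_basis_mem by (intro sum.cong) auto
  also have "\<dots> = (\<Sum>e'\<in>E. \<Sum>e\<in>E. ip (f e') e * ip (h e) e')"
    by (subst sum.swap) (simp add: mult.commute)
  also have "\<dots> = (\<Sum>e\<in>E. ip (h (f e)) e)"
    using ip_linear_expand[OF assms(3,4)] eg orthonormal_basis_mem by (intro sum.cong) auto
  finally show ?thesis .
qed

text \<open>By the Jacobi identity ad of a bracket is the commutator of the two ad operators, and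
  commutators have trace 0.\<close>

lemma trace_ad_br:
  assumes x: "x \<in> g" and y: "y \<in> g"
  shows "(\<Sum>e\<in>E. ip (br (br x y) e) e) = 0"
proof -
  have "ip (br (br x y) e) e = ip (br x (br y e)) e - ip (br y (br x e)) e" if "e \<in> E" for e
  proof -
    have e: "e \<in> g" using orthonormal_basis_mem that by auto
    have "br (br x y) e = - br e (br x y)" using x y e br_closed br_anticommute by blast
    moreover have "br y (br e x) = - br y (br x e)"
      using x y e br_anticommute[of e x] br_scale_right[of "br x e" y "-1"] br_closed by simp
    moreover have "br x (br y e) + br y (br e x) + br e (br x y) = 0" using x y e jacobi by blast
    ultimately have "br e (br x y) = - (br x (br y e) - br y (br x e))"
      by (simp add: add_eq_0_iff)
    with \<open>br (br x y) e = - br e (br x y)\<close> have "br (br x y) e = br x (br y e) - br y (br x e)"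
      by simp
    then show ?thesis using x y e by (simp add: ip_diff_left br_closed)
  qed
  then have "(\<Sum>e\<in>E. ip (br (br x y) e) e)
      = (\<Sum>e\<in>E. ip (br x (br y e)) e - ip (br y (br x e)) e)"
    by (rule sum.cong[OF refl])
  also have "\<dots> = (\<Sum>e\<in>E. ip (br x (br y e)) e) - (\<Sum>e\<in>E. ip (br y (br x e)) e)"
    by (rule sum_subtractf)
  also have "\<dots> = 0"
    using trace_compose_commute[OF linear_br_right br_image linear_br_right br_image] x y by simp
  finally show ?thesis .
qed

text \<open>Milnor's formula for the Ricci curvature of a left-invariant metric; \<open>H\<close> is the mean
  curvature vector.\<close>

lemma ricci_form_eq:
  assumes x: "x \<in> g" and y: "y \<in> g" and H: "H \<in> g"
    and mean_curvature: "\<And>z. z \<in> g \<Longrightarrow> ip H z = (\<Sum>e\<in>E. ip (br z e) e)"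
  shows "ricci_form x y =
    (\<Sum>e\<in>E. \<Sum>f\<in>E. ip (br e f) x * ip (br e f) y) / 4
    - (\<Sum>e\<in>E. ip (br x e) (br y e)) / 2
    - (\<Sum>e\<in>E. ip (br x (br y e)) e) / 2
    - (ip (br H x) y + ip (br H y) x) / 2"
proof -
  note closed = levi_civita_closed br_closed orthonormal_basis_mem x y H
  have "ricci_form x y = (\<Sum>e\<in>E. ip (curvature e x y) e)"
    using E x y by (rule ricci_form_orthonormal)
  also have "\<dots> = (\<Sum>e\<in>E. ip (levi_civita e (levi_civita x y)) e
      + ip (levi_civita e y) (levi_civita x e) - ip (levi_civita (br e x) y) e)"
  proof (rule sum.cong[OF refl])
    fix e assume "e \<in> E"
    then have e: "e \<in> g" by (rule orthonormal_basis_mem)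
    \<comment> \<open>Skewness moves the outer derivative along \<open>x\<close> to the other side,
      so no second derivative is left in this term.\<close>
    have "ip (levi_civita x (levi_civita e y)) e = - ip (levi_civita e y) (levi_civita x e)"
      using e by (intro levi_civita_skew levi_civita_closed x y)
    then show "ip (curvature e x y) e = ip (levi_civita e (levi_civita x y)) e
      + ip (levi_civita e y) (levi_civita x e) - ip (levi_civita (br e x) y) e"
      using e x y by (simp add: curvature_def ip_diff_left closed subspace_diff[OF subspace])
  qed
  also have "\<dots> = (\<Sum>e\<in>E. ip (levi_civita e (levi_civita x y)) e)
      + (\<Sum>e\<in>E. ip (levi_civita e y) (levi_civita x e)) - (\<Sum>e\<in>E. ip (levi_civita (br e x) y) e)"
    by (simp add: sum.distrib sum_subtractf)
  \<comment> \<open>By the Koszul formula the divergence of a left-invariant field z is minus the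
    trace of ad z, so this sum is minus the product of \<open>H\<close> with
    \<open>levi_civita x y\<close>. A second use of the formula leaves brackets with
    \<open>H\<close>; the product of \<open>br x y\<close> with \<open>H\<close> is the trace of ad
    of a bracket and vanishes.\<close>
  also have "(\<Sum>e\<in>E. ip (levi_civita e (levi_civita x y)) e) = - (ip (br H x) y + ip (br H y) x) / 2"
  proof -
    have "ip (levi_civita e z) e = - ip (br z e) e" if "e \<in> E" "z \<in> g" for e z
      using that orthonormal_basis_mem[of e] br_anticommute[of e z]
      by (simp add: koszul ip_minus_left br_closed br_self)
    then have "(\<Sum>e\<in>E. ip (levi_civita e (levi_civita x y)) e) = - ip H (levi_civita x y)"
      using mean_curvature[of "levi_civita x y"] closed by (simp add: sum_negf)
    also have "ip H (levi_civita x y) = ip (levi_civita x y) H"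
      using closed by (intro ip_commute) auto
    also have "\<dots> = (ip (br x y) H - ip (br y H) x + ip (br H x) y) / 2"
      using x y H by (rule koszul)
    also have "ip (br x y) H = 0"
      using trace_ad_br[OF x y] mean_curvature[of "br x y"] ip_commute[of "br x y" H] closed by simp
    also have "ip (br y H) x = - ip (br H y) x"
      using br_anticommute[of y H] closed by (simp add: ip_minus_left)
    finally show ?thesis by (simp add: field_simps)
  qed
  also have "(\<Sum>e\<in>E. ip (levi_civita e y) (levi_civita x e)) =
      (\<Sum>e\<in>E. \<Sum>f\<in>E. ip (br e f) x * ip (br e f) y) / 4
      - (\<Sum>e\<in>E. \<Sum>f\<in>E. ip (br x e) f * ip (br e f) y) / 2"
    (is "?L = _")
  proof -
    \<comment> \<open>\<open>X\<close> and \<open>Y\<close> are the matrices of ad x and ad y, while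
      \<open>A\<close> and \<open>B\<close> are antisymmetric. In the product of Koszul expressions
      the second factor is antisymmetric in \<open>e\<close>, \<open>f\<close>; the contribution of
      \<open>Y\<close> to the first factor is symmetric and therefore sums to 0.\<close>
    define X where "X e f = ip (br x e) f" for e f
    define Y where "Y e f = ip (br y e) f" for e f
    define A where "A e f = ip (br e f) x" for e f
    define B where "B e f = ip (br e f) y" for e f
    have anti: "A f e = - A e f" "B f e = - B e f" if "e \<in> E" "f \<in> E" for e f
      using that br_anticommute[of f e] closed unfolding A_def B_def by (simp_all add: ip_minus_left)
    have "?L = (\<Sum>e\<in>E. \<Sum>f\<in>E. ip (levi_civita e y) f * ip (levi_civita x e) f)"
      using closed by (intro sum.cong parseval) auto
    also have "\<dots> = (\<Sum>e\<in>E. \<Sum>f\<in>E. (- Y e f - Y f e - B e f) / 2 * ((X e f - A e f - X f e) / 2))"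
    proof (intro sum.cong refl)
      fix e f assume "e \<in> E" "f \<in> E"
      then have ef: "e \<in> g" "f \<in> g" using orthonormal_basis_mem by auto
      have "ip (br e y) f = - Y e f" "ip (br f x) e = - X f e" "ip (br f e) y = - B e f"
        using ef br_anticommute[of e y] br_anticommute[of f x] br_anticommute[of f e] closed
        unfolding X_def Y_def B_def by (simp_all add: ip_minus_left)
      then show "ip (levi_civita e y) f * ip (levi_civita x e) f =
          (- Y e f - Y f e - B e f) / 2 * ((X e f - A e f - X f e) / 2)"
        using ef x y by (simp add: koszul X_def Y_def A_def B_def)
    qed
    also have "\<dots> = (\<Sum>e\<in>E. \<Sum>f\<in>E. A e f * B e f) / 4 - (\<Sum>e\<in>E. \<Sum>f\<in>E. X e f * B e f) / 2"
    proof -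
      have sym0: "(\<Sum>e\<in>E. \<Sum>f\<in>E. S e f * W e f) = 0"
        if "\<And>e f. e \<in> E \<Longrightarrow> f \<in> E \<Longrightarrow> S f e = S e f" "\<And>e f. e \<in> E \<Longrightarrow> f \<in> E \<Longrightarrow> W f e = - W e f"
        for S W :: "'a \<Rightarrow> 'a \<Rightarrow> real"
      proof -
        have "(\<Sum>e\<in>E. \<Sum>f\<in>E. S e f * W e f) = (\<Sum>f\<in>E. \<Sum>e\<in>E. S e f * W e f)" by (rule sum.swap)
        also have "\<dots> = (\<Sum>f\<in>E. \<Sum>e\<in>E. - (S f e * W f e))"
        proof (intro sum.cong refl)
          fix f e assume "f \<in> E" "e \<in> E"
          then show "S e f * W e f = - (S f e * W f e)" using that[of e f] by simp
        qed
        also have "\<dots> = - (\<Sum>e\<in>E. \<Sum>f\<in>E. S e f * W e f)" by (simp add: sum_negf)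
        finally show ?thesis by simp
      qed
      \<comment> \<open>Against the antisymmetric \<open>B\<close>, transposing \<open>X\<close>
        costs a sign, so the two remaining mixed sums combine into one.\<close>
      have sw: "(\<Sum>e\<in>E. \<Sum>f\<in>E. X f e * B e f) = - (\<Sum>e\<in>E. \<Sum>f\<in>E. X e f * B e f)"
      proof -
        have "(\<Sum>e\<in>E. \<Sum>f\<in>E. X f e * B e f) = (\<Sum>f\<in>E. \<Sum>e\<in>E. X f e * B e f)" by (rule sum.swap)
        also have "\<dots> = (\<Sum>f\<in>E. \<Sum>e\<in>E. - (X f e * B f e))"
        proof (intro sum.cong refl)
          fix f e assume "f \<in> E" "e \<in> E"
          then show "X f e * B e f = - (X f e * B f e)" using anti(2)[of e f] by simp
        qed
        finally show ?thesis by (simp add: sum_negf)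
      qed
      have "(\<Sum>e\<in>E. \<Sum>f\<in>E. (- Y e f - Y f e - B e f) / 2 * ((X e f - A e f - X f e) / 2)) =
        (\<Sum>e\<in>E. \<Sum>f\<in>E. (A e f * B e f) / 4 - X e f * B e f / 4 + X f e * B e f / 4
           - ((Y e f + Y f e) * (X e f - A e f - X f e)) / 4)"
        by (intro sum.cong refl) (simp add: field_simps)
      also have "\<dots> = (\<Sum>e\<in>E. \<Sum>f\<in>E. A e f * B e f) / 4 - (\<Sum>e\<in>E. \<Sum>f\<in>E. X e f * B e f) / 4
          + (\<Sum>e\<in>E. \<Sum>f\<in>E. X f e * B e f) / 4
          - (\<Sum>e\<in>E. \<Sum>f\<in>E. (Y e f + Y f e) * (X e f - A e f - X f e)) / 4"
        by (simp only: sum.distrib sum_subtractf sum_divide_distrib)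
      also have "(\<Sum>e\<in>E. \<Sum>f\<in>E. (Y e f + Y f e) * (X e f - A e f - X f e)) = 0"
      proof (rule sym0)
        fix e f assume "e \<in> E" "f \<in> E"
        then show "X f e - A f e - X e f = - (X e f - A e f - X f e)" using anti(1)[of e f] by simp
      qed simp
      finally show ?thesis using sw by simp
    qed
    finally show ?thesis unfolding A_def B_def X_def .
  qed
  \<comment> \<open>The last double sum is the mixed sum already met in the previous term; the two
    cancel, as this whole expression is subtracted.\<close>
  also have "(\<Sum>e\<in>E. ip (levi_civita (br e x) y) e) =
      (\<Sum>e\<in>E. ip (br x (br y e)) e) / 2 + (\<Sum>e\<in>E. ip (br x e) (br y e)) / 2
      - (\<Sum>e\<in>E. \<Sum>f\<in>E. ip (br x e) f * ip (br e f) y) / 2"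
  proof -
    have "ip (levi_civita (br e x) y) e =
        ip (br y (br x e)) e / 2 + ip (br x e) (br y e) / 2 - (\<Sum>f\<in>E. ip (br x e) f * ip (br e f) y) / 2"
      if "e \<in> E" for e
    proof -
      have e: "e \<in> g" using that by (rule orthonormal_basis_mem)
      have a: "br e x = - br x e" using e x by (rule br_anticommute)
      have b: "br (br e x) y = br y (br x e)"
        using br_anticommute[OF br_closed[OF e x] y] a br_scale_right[of "br x e" y "-1"] e closed
        by simp
      have c: "ip (br y e) (br e x) = - ip (br x e) (br y e)"
        using a e closed ip_commute[of "br y e" "br x e"] by (simp add: ip_minus_right)
      have "br e (br e x) = - br e (br x e)"
        using a br_scale_right[of "br x e" e "-1"] e closed by simp
      then have "ip (br e (br e x)) y = - ip (br e (br x e)) y"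
        using e closed by (simp add: ip_minus_left)
      also have "ip (br e (br x e)) y = (\<Sum>f\<in>E. ip (br x e) f * ip (br e f) y)"
        using e closed by (intro ip_linear_expand linear_br_right) auto
      finally have d: "ip (br e (br e x)) y = - (\<Sum>f\<in>E. ip (br x e) f * ip (br e f) y)" .
      have "ip (levi_civita (br e x) y) e =
          (ip (br (br e x) y) e - ip (br y e) (br e x) + ip (br e (br e x)) y) / 2"
        using e closed by (intro koszul) auto
      then show ?thesis unfolding b c d by (simp add: field_simps)
    qed
    then have "(\<Sum>e\<in>E. ip (levi_civita (br e x) y) e) = (\<Sum>e\<in>E. ip (br y (br x e)) e / 2
        + ip (br x e) (br y e) / 2 - (\<Sum>f\<in>E. ip (br x e) f * ip (br e f) y) / 2)"
      by (rule sum.cong[OF refl])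
    also have "\<dots> = (\<Sum>e\<in>E. ip (br y (br x e)) e) / 2 + (\<Sum>e\<in>E. ip (br x e) (br y e)) / 2
      - (\<Sum>e\<in>E. \<Sum>f\<in>E. ip (br x e) f * ip (br e f) y) / 2"
      by (simp only: sum.distrib sum_subtractf sum_divide_distrib)
    also have "(\<Sum>e\<in>E. ip (br y (br x e)) e) = (\<Sum>e\<in>E. ip (br x (br y e)) e)"
      using trace_compose_commute[OF linear_br_right br_image linear_br_right br_image] x y by simp
    finally show ?thesis .
  qed
  finally show ?thesis by (simp add: field_simps)
qed

end

end

section \<open>The path algebra\<close>

lemma lookup_scaleR [simp]: "Poly_Mapping.lookup (c *\<^sub>R f) k = c *\<^sub>R Poly_Mapping.lookup f k"
  by transfer simp

abbreviation basis_path :: "'k \<Rightarrow> ('k \<Rightarrow>\<^sub>0 real)" where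
  "basis_path k \<equiv> Poly_Mapping.single k 1"

lemma poly_mapping_expand:
  assumes "finite K" "Poly_Mapping.keys f \<subseteq> K"
  shows "f = (\<Sum>k\<in>K. Poly_Mapping.lookup f k *\<^sub>R basis_path k)"
proof (rule poly_mapping_eqI)
  fix x
  have "Poly_Mapping.lookup (\<Sum>k\<in>K. Poly_Mapping.lookup f k *\<^sub>R basis_path k) x
      = (\<Sum>k\<in>K. if k = x then Poly_Mapping.lookup f k else 0)"
    by (auto simp: lookup_sum lookup_single when_def intro!: sum.cong)
  also have "\<dots> = Poly_Mapping.lookup f x"
    using assms by (auto simp: sum.delta in_keys_iff)
  finally show "Poly_Mapping.lookup f x
      = Poly_Mapping.lookup (\<Sum>k\<in>K. Poly_Mapping.lookup f k *\<^sub>R basis_path k) x" ..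
qed

lemma span_basis_path:
  "span (basis_path ` K) = {f :: 'k \<Rightarrow>\<^sub>0 real. Poly_Mapping.keys f \<subseteq> K}" (is "_ = ?R")
proof
  have "subspace ?R"
    unfolding subspace_def by (auto simp: in_keys_iff lookup_add subset_iff) (metis add_0)
  moreover have "basis_path ` K \<subseteq> ?R" by auto
  ultimately show "span (basis_path ` K) \<subseteq> ?R" by (rule span_minimal[rotated])
  show "?R \<subseteq> span (basis_path ` K)"
  proof
    fix f assume f: "f \<in> ?R"
    have "f = (\<Sum>k\<in>Poly_Mapping.keys f. Poly_Mapping.lookup f k *\<^sub>R basis_path k)"
      by (intro poly_mapping_expand) auto
    also have "\<dots> \<in> span (basis_path ` K)"
      using f by (intro span_sum span_scale span_base) auto
    finally show "f \<in> span (basis_path ` K)" .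
  qed
qed

lemma span_basis_path_UNIV: "span (range basis_path) = (UNIV :: ('k \<Rightarrow>\<^sub>0 real) set)"
  by (simp add: span_basis_path)

text \<open>Additional indices carry coefficient 0. Additivity compares products whose arguments
  have different supports, so a common index set is required.\<close>

lemma path_mult_alt:
  assumes "finite A" "Poly_Mapping.keys f \<subseteq> A" "finite B" "Poly_Mapping.keys h \<subseteq> B"
  shows "path_mult f h =
    (\<Sum>x\<in>A. \<Sum>y\<in>B. (Poly_Mapping.lookup f x * Poly_Mapping.lookup h y) *\<^sub>R path_concat x y)"
proof -
  let ?t = "\<lambda>x y. (Poly_Mapping.lookup f x * Poly_Mapping.lookup h y) *\<^sub>R path_concat x y"
  have "path_mult f h = (\<Sum>x\<in>Poly_Mapping.keys f. \<Sum>y\<in>B. ?t x y)"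
    unfolding path_mult_def using assms
    by (intro sum.cong sum.mono_neutral_left) (auto simp: in_keys_iff)
  also have "\<dots> = (\<Sum>x\<in>A. \<Sum>y\<in>B. ?t x y)"
    using assms by (intro sum.mono_neutral_left) (auto simp: in_keys_iff)
  finally show ?thesis .
qed

lemma path_mult_basis: "path_mult (basis_path x) (basis_path y) = path_concat x y"
  by (simp add: path_mult_def)

lemma linear_path_mult_right: "linear (path_mult f)"
  for f :: "('v, 'e) qpath \<Rightarrow>\<^sub>0 real"
proof
  fix h h' :: "('v, 'e) qpath \<Rightarrow>\<^sub>0 real"
  let ?B = "Poly_Mapping.keys h \<union> Poly_Mapping.keys h'"
  note alt = path_mult_alt[where A = "Poly_Mapping.keys f" and B = ?B]
  have "path_mult f (h + h') = (\<Sum>x\<in>Poly_Mapping.keys f. \<Sum>y\<in>?B.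
      (Poly_Mapping.lookup f x * Poly_Mapping.lookup (h + h') y) *\<^sub>R path_concat x y)"
    using Poly_Mapping.keys_add[of h h'] by (intro alt) auto
  also have "\<dots> = path_mult f h + path_mult f h'"
    by (simp add: alt lookup_add algebra_simps sum.distrib)
  finally show "path_mult f (h + h') = path_mult f h + path_mult f h'" .
next
  fix c h
  have "path_mult f (c *\<^sub>R h) = (\<Sum>x\<in>Poly_Mapping.keys f. \<Sum>y\<in>Poly_Mapping.keys h.
      (Poly_Mapping.lookup f x * Poly_Mapping.lookup (c *\<^sub>R h) y) *\<^sub>R path_concat x y)"
    by (intro path_mult_alt) (auto simp: in_keys_iff)
  then show "path_mult f (c *\<^sub>R h) = c *\<^sub>R path_mult f h"
    by (simp add: path_mult_def scaleR_sum_right algebra_simps)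
qed

lemma linear_path_mult_left: "linear (\<lambda>f. path_mult f h)"
  for h :: "('v, 'e) qpath \<Rightarrow>\<^sub>0 real"
proof
  fix f f' :: "('v, 'e) qpath \<Rightarrow>\<^sub>0 real"
  let ?A = "Poly_Mapping.keys f \<union> Poly_Mapping.keys f'"
  note alt = path_mult_alt[where B = "Poly_Mapping.keys h" and A = ?A]
  have "path_mult (f + f') h = (\<Sum>x\<in>?A. \<Sum>y\<in>Poly_Mapping.keys h.
      (Poly_Mapping.lookup (f + f') x * Poly_Mapping.lookup h y) *\<^sub>R path_concat x y)"
    using Poly_Mapping.keys_add[of f f'] by (intro alt) auto
  also have "\<dots> = path_mult f h + path_mult f' h"
    by (simp add: alt lookup_add algebra_simps sum.distrib)
  finally show "path_mult (f + f') h = path_mult f h + path_mult f' h" .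
next
  fix c f
  have "path_mult (c *\<^sub>R f) h = (\<Sum>x\<in>Poly_Mapping.keys f. \<Sum>y\<in>Poly_Mapping.keys h.
      (Poly_Mapping.lookup (c *\<^sub>R f) x * Poly_Mapping.lookup h y) *\<^sub>R path_concat x y)"
    by (intro path_mult_alt) (auto simp: in_keys_iff)
  then show "path_mult (c *\<^sub>R f) h = c *\<^sub>R path_mult f h"
    by (simp add: path_mult_def scaleR_sum_right algebra_simps)
qed

lemma linear_eq_basis_path:
  assumes "linear F" "linear G" "\<And>k. F (basis_path k) = G (basis_path k)"
  shows "F f = G f"
  using linear_eq_on[OF assms(1,2), of f "range basis_path"] assms(3) span_basis_path_UNIV by blast

lemmas path_mult_zero [simp] = linear_0[OF linear_path_mult_right] linear_0[OF linear_path_mult_left]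
lemmas path_mult_diff = linear_diff[OF linear_path_mult_right] linear_diff[OF linear_path_mult_left]

lemma path_concat_assoc:
  "path_mult (path_concat x y) (basis_path z) = path_mult (basis_path x) (path_concat y z)"
  by (cases x; cases y; cases z) (auto simp: path_mult_basis)

text \<open>Concatenation is associative on arbitrary triples, walks or not, so the identity holds
  in the whole ambient space; each argument in turn is reduced to a basis vector by
  linearity.\<close>

lemma path_mult_assoc: "path_mult (path_mult f g) h = path_mult f (path_mult g h)"
proof (rule linear_eq_basis_path[where F = "\<lambda>f. path_mult (path_mult f g) h"])
  show "linear (\<lambda>f. path_mult (path_mult f g) h)"
    using linear_compose[OF linear_path_mult_left linear_path_mult_left] by (simp add: o_def)
  show "linear (\<lambda>f. path_mult f (path_mult g h))" by (rule linear_path_mult_left)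
  fix x
  show "path_mult (path_mult (basis_path x) g) h = path_mult (basis_path x) (path_mult g h)"
  proof (rule linear_eq_basis_path[where f = g])
    show "linear (\<lambda>g. path_mult (path_mult (basis_path x) g) h)"
      using linear_compose[OF linear_path_mult_right linear_path_mult_left] by (simp add: o_def)
    show "linear (\<lambda>g. path_mult (basis_path x) (path_mult g h))"
      using linear_compose[OF linear_path_mult_left linear_path_mult_right] by (simp add: o_def)
    fix y
    show "path_mult (path_mult (basis_path x) (basis_path y)) h
      = path_mult (basis_path x) (path_mult (basis_path y) h)"
    proof (rule linear_eq_basis_path[where f = h])
      show "linear (path_mult (path_mult (basis_path x) (basis_path y)))"
        by (rule linear_path_mult_right)
      show "linear (\<lambda>h. path_mult (basis_path x) (path_mult (basis_path y) h))"
        using linear_compose[OF linear_path_mult_right linear_path_mult_right] by (simp add: o_def)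
    qed (simp add: path_mult_basis path_concat_assoc)
  qed
qed

lemma linear_path_bracket_right: "linear (path_bracket f)"
  unfolding path_bracket_def[abs_def]
  by (intro linear_compose_sub linear_path_mult_left linear_path_mult_right)

lemma linear_path_bracket_left: "linear (\<lambda>f. path_bracket f h)"
  unfolding path_bracket_def[abs_def]
  by (intro linear_compose_sub linear_path_mult_left linear_path_mult_right)

lemma linear_within_if_linear: "linear f \<Longrightarrow> linear_within g f"
  by (simp add: linear_within_def linear_add linear_scale)

lemma bilinear_path_bracket: "bilinear_within g path_bracket"
  unfolding bilinear_within_def
  using linear_path_bracket_left linear_path_bracket_right by (blast intro: linear_within_if_linear)

lemma path_bracket_jacobi:
  "path_bracket x (path_bracket y z) + path_bracket y (path_bracket z x)
    + path_bracket z (path_bracket x y) = 0"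
  by (simp add: path_bracket_def path_mult_diff path_mult_assoc)

lemma path_algebra_eq_span: "path_algebra Q = span (basis_path ` quiver_paths Q)"
  by (simp add: path_algebra_def span_basis_path)

lemma path_mult_closed_within:
  assumes S: "subspace S" and "\<And>p q. p \<in> Poly_Mapping.keys f \<Longrightarrow> q \<in> Poly_Mapping.keys h \<Longrightarrow> path_concat p q \<in> S"
  shows "path_mult f h \<in> S"
  unfolding path_mult_def
  by (intro subspace_sum[OF S] subspace_scale[OF S] assms(2))

section \<open>The filtration by path length\<close>

abbreviation path_length :: "('v, 'e) qpath \<Rightarrow> nat" where
  "path_length k \<equiv> length (fst (snd k))"

abbreviation source :: "('v, 'e) qpath \<Rightarrow> 'v" where
  "source k \<equiv> fst k"

abbreviation target :: "('v, 'e) qpath \<Rightarrow> 'v" where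
  "target k \<equiv> snd (snd k)"

lemma subspace_keys: "subspace {f :: 'k \<Rightarrow>\<^sub>0 real. \<forall>k\<in>Poly_Mapping.keys f. P k}"
  using subspace_span[of "basis_path ` Collect P"] unfolding span_basis_path
  by (simp add: subset_iff Ball_def)

text \<open>Descending filtration compatible with the product. It is the device for showing that a
  coefficient vanishes: multiplication by something of degree at least 1 lengthens every
  path.\<close>

definition in_degree_ge :: "nat \<Rightarrow> (('v, 'e) qpath \<Rightarrow>\<^sub>0 real) set" where
  "in_degree_ge n = {f. \<forall>k\<in>Poly_Mapping.keys f. n \<le> path_length k}"

lemma subspace_in_degree_ge: "subspace (in_degree_ge n)"
  unfolding in_degree_ge_def by (rule subspace_keys)

lemma lookup_eq_0_if_degree:
  assumes "f \<in> in_degree_ge n" "path_length k < n"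
  shows "Poly_Mapping.lookup f k = 0"
  using assms unfolding in_degree_ge_def by (force simp: in_keys_iff)

lemma basis_path_in_degree_ge [simp]: "basis_path k \<in> in_degree_ge n \<longleftrightarrow> n \<le> path_length k"
  by (simp add: in_degree_ge_def)

lemma path_mult_degree:
  assumes "f \<in> in_degree_ge m" "h \<in> in_degree_ge n"
  shows "path_mult f h \<in> in_degree_ge (m + n)"
proof (rule path_mult_closed_within[OF subspace_in_degree_ge])
  fix p q assume "p \<in> Poly_Mapping.keys f" "q \<in> Poly_Mapping.keys h"
  then have "m \<le> path_length p" "n \<le> path_length q" using assms by (auto simp: in_degree_ge_def)
  then show "path_concat p q \<in> in_degree_ge (m + n)"
    by (cases p; cases q) (auto intro: subspace_0[OF subspace_in_degree_ge])
qed

lemma path_bracket_degree: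
  assumes "f \<in> in_degree_ge m" "h \<in> in_degree_ge n"
  shows "path_bracket f h \<in> in_degree_ge (m + n)"
  unfolding path_bracket_def
  using path_mult_degree[OF assms] path_mult_degree[OF assms(2,1)]
  by (intro subspace_diff[OF subspace_in_degree_ge]) (auto simp: add.commute)

context wf_digraph
begin

lemma path_concat_in_path_algebra:
  assumes "p \<in> quiver_paths G" "q \<in> quiver_paths G"
  shows "path_concat p q \<in> path_algebra G"
  using assms awalk_appendI
  by (cases p; cases q) (auto simp: path_algebra_def quiver_paths_def)

lemma subspace_path_algebra: "subspace (path_algebra G)"
  unfolding path_algebra_eq_span by (rule subspace_span)

lemma path_mult_in_path_algebra:
  assumes "f \<in> path_algebra G" "h \<in> path_algebra G"
  shows "path_mult f h \<in> path_algebra G"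
proof (rule path_mult_closed_within[OF subspace_path_algebra])
  fix p q assume "p \<in> Poly_Mapping.keys f" "q \<in> Poly_Mapping.keys h"
  then show "path_concat p q \<in> path_algebra G"
    using assms by (intro path_concat_in_path_algebra) (auto simp: path_algebra_def)
qed

lemma path_bracket_in_path_algebra:
  assumes "f \<in> path_algebra G" "h \<in> path_algebra G"
  shows "path_bracket f h \<in> path_algebra G"
  unfolding path_bracket_def
  using assms by (intro subspace_diff[OF subspace_path_algebra] path_mult_in_path_algebra)

lemma lie_algebra_path_algebra: "lie_algebra_within (path_algebra G) path_bracket"
  using subspace_path_algebra path_bracket_in_path_algebra bilinear_path_bracket path_bracket_jacobi
  by unfold_locales (auto simp: path_bracket_def)

end

locale acyclic_quiver = fin_digraph Q for Q :: "('v, 'e) pre_digraph" +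
  assumes acyclic: "quiver_acyclic Q" and connected: "weakly_connected Q"
begin

text \<open>A walk that repeats a vertex contains a closed subwalk of positive length. Without
  cycles all walks are therefore simple, and a finite digraph has only finitely many simple
  walks.\<close>

lemma finite_paths: "finite (quiver_paths Q)"
proof (rule finite_subset[OF _ apaths_finite_triple])
  show "quiver_paths Q \<subseteq> {(u, p, v). apath u p v}"
  proof (clarsimp simp: quiver_paths_def apath_def)
    fix u p v assume p: "awalk u p v"
    show "distinct (awalk_verts u p)"
    proof (rule ccontr)
      assume "\<not> distinct (awalk_verts u p)"
      then obtain q r s where "0 < length r" "\<exists>w. awalk u q w \<and> awalk w r w \<and> awalk w s v"
        using awalk_not_distinct_decomp[OF p] by metis
      then show False using acyclic unfolding quiver_acyclic_def quiver_paths_def by auto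
    qed
  qed
qed

lemma no_cycle: "k \<in> quiver_paths Q \<Longrightarrow> source k = target k \<Longrightarrow> fst (snd k) = []"
  using acyclic unfolding quiver_acyclic_def by (cases k) auto

end

section \<open>An inner product on the path algebra of an acyclic quiver\<close>

lemma linear_mem_on_span_basis_path:
  assumes "linear F" "subspace S" "\<And>k. k \<in> K \<Longrightarrow> F (basis_path k) \<in> S" "f \<in> span (basis_path ` K)"
  shows "F f \<in> S"
proof -
  have "basis_path ` K \<subseteq> F -` S" using assms(3) by auto
  then have "span (basis_path ` K) \<subseteq> F -` S"
    using linear_subspace_vimage[OF assms(1,2)] by (rule span_minimal)
  then show ?thesis using assms(4) by auto
qed

abbreviation vertex_path :: "'v \<Rightarrow> ('v, 'e) qpath" where
  "vertex_path v \<equiv> (v, [], v)"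

text \<open>The weight of \<open>k\<close>, extended from vertex combinations to a linear functional
  on the whole space that ignores all coefficients of longer paths.\<close>

definition weight_diff :: "('v, 'e) qpath \<Rightarrow> (('v, 'e) qpath \<Rightarrow>\<^sub>0 real) \<Rightarrow> real" where
  "weight_diff k f =
     Poly_Mapping.lookup f (vertex_path (source k)) - Poly_Mapping.lookup f (vertex_path (target k))"

lemma linear_weight_diff: "linear (weight_diff k)"
  by unfold_locales (simp_all add: weight_diff_def lookup_add algebra_simps)

context acyclic_quiver
begin

definition long_paths :: "('v, 'e) qpath set" where
  "long_paths = {k \<in> quiver_paths Q. fst (snd k) \<noteq> []}"

definition out_count :: "'v \<Rightarrow> nat" where
  "out_count v = card {k \<in> long_paths. source k = v}"

definition in_count :: "'v \<Rightarrow> nat" where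
  "in_count v = card {k \<in> long_paths. target k = v}"

text \<open>With this choice \<open>w v * (1 + out_count v + in_count v) = 1\<close>, which is exactly what makes the
  Ricci eigenvalue of a path, shifted by \<open>1/2\<close>, additive under concatenation.\<close>

definition vertex_weight :: "'v \<Rightarrow> real" where
  "vertex_weight v = 1 / (1 + out_count v + in_count v)"

text \<open>The head of the last arrow is the target and is left out. A single arrow thus has empty
  interior and \<open>path_norm\<close> 1.\<close>

definition interior :: "('v, 'e) qpath \<Rightarrow> 'v list" where
  "interior k = map (head Q) (butlast (fst (snd k)))"

definition path_norm :: "('v, 'e) qpath \<Rightarrow> real" where
  "path_norm k = prod_list (map vertex_weight (interior k))"

definition vertex_sum :: "(('v, 'e) qpath \<Rightarrow>\<^sub>0 real) \<Rightarrow> real" where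
  "vertex_sum f = (\<Sum>v\<in>verts Q. Poly_Mapping.lookup f (vertex_path v))"

text \<open>On the span of the vertices the middle term is the form that the Ricci curvature reproduces up to
  the factor \<open>-1/2\<close>; its kernel is spanned by the sum of all vertices (by connectedness), and the
  last term makes the inner product definite there.\<close>

definition path_ip :: "(('v, 'e) qpath \<Rightarrow>\<^sub>0 real) \<Rightarrow> (('v, 'e) qpath \<Rightarrow>\<^sub>0 real) \<Rightarrow> real" where
  "path_ip f h =
     (\<Sum>k\<in>long_paths. path_norm k * (Poly_Mapping.lookup f k * Poly_Mapping.lookup h k))
     + 2 * (\<Sum>k\<in>long_paths. weight_diff k f * weight_diff k h) + vertex_sum f * vertex_sum h"

abbreviation cartan :: "(('v, 'e) qpath \<Rightarrow>\<^sub>0 real) set" where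
  "cartan \<equiv> span (basis_path ` vertex_path ` verts Q)"

lemma vertex_weight_pos: "vertex_weight v > 0"
  unfolding vertex_weight_def by (intro divide_pos_pos) linarith+

lemma path_norm_pos: "path_norm k > 0"
proof -
  have "prod_list (map vertex_weight vs) > 0" for vs
    by (induction vs) (auto simp: vertex_weight_pos)
  then show ?thesis by (simp add: path_norm_def)
qed

lemma finite_long_paths: "finite long_paths"
  using finite_paths by (simp add: long_paths_def)

lemma quiver_paths_eq: "quiver_paths Q = vertex_path ` verts Q \<union> long_paths"
  by (auto simp: long_paths_def quiver_paths_def awalk_Nil_iff)

lemma source_target_in_verts:
  assumes "k \<in> quiver_paths Q"
  shows "source k \<in> verts Q" "target k \<in> verts Q"
  using assms by (auto simp: quiver_paths_def)

lemma source_neq_target: "k \<in> long_paths \<Longrightarrow> source k \<noteq> target k"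
  using no_cycle[of k] by (auto simp: long_paths_def)

lemma long_path_length: "k \<in> long_paths \<Longrightarrow> 1 \<le> path_length k"
  by (auto simp: long_paths_def Suc_le_eq)

lemma vertex_path_not_long [simp]: "vertex_path v \<notin> long_paths"
  by (auto simp: long_paths_def)

lemma linear_vertex_sum: "linear vertex_sum"
  by unfold_locales (simp_all add: vertex_sum_def lookup_add sum.distrib sum_distrib_left)

lemma weight_diff_eq_0_if_degree: "f \<in> in_degree_ge 1 \<Longrightarrow> weight_diff k f = 0"
  by (simp add: weight_diff_def lookup_eq_0_if_degree)

lemma vertex_sum_eq_0_if_degree: "f \<in> in_degree_ge 1 \<Longrightarrow> vertex_sum f = 0"
  by (simp add: vertex_sum_def lookup_eq_0_if_degree)

lemma path_ip_commute: "path_ip f h = path_ip h f"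
  by (simp add: path_ip_def mult.commute)

lemma linear_path_ip: "linear (path_ip f)"
  by unfold_locales
     (simp_all add: path_ip_def lookup_add linear_add[OF linear_weight_diff] linear_scale[OF linear_weight_diff]
       linear_add[OF linear_vertex_sum] linear_scale[OF linear_vertex_sum] algebra_simps sum.distrib sum_distrib_left)

text \<open>Each arrow is a path of length 1, so vanishing weights equate the coefficients at its
  two ends; weak connectedness carries the equality to any pair of vertices through the symmetrised
  digraph.\<close>

lemma vertex_coefficients_constant:
  assumes "\<And>k. k \<in> long_paths \<Longrightarrow> weight_diff k f = 0" "u \<in> verts Q" "v \<in> verts Q"
  shows "Poly_Mapping.lookup f (vertex_path u) = Poly_Mapping.lookup f (vertex_path v)"
proof -
  have arc: "Poly_Mapping.lookup f (vertex_path (tail Q e)) = Poly_Mapping.lookup f (vertex_path (head Q e))"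
    if "e \<in> arcs Q" for e
  proof -
    have "(tail Q e, [e], head Q e) \<in> long_paths"
      using that by (auto simp: long_paths_def quiver_paths_def awalk_Cons_iff awalk_Nil_iff)
    then show ?thesis using assms(1) by (force simp: weight_diff_def)
  qed
  have reach: "u \<rightarrow>\<^sup>*\<^bsub>with_proj (mk_symmetric Q)\<^esub> v"
    using connected assms(2,3) unfolding Digraph_Component.connected_def strongly_connected_def by auto
  interpret S: pair_wf_digraph "mk_symmetric Q" ..
  from reach show ?thesis
  proof (induction rule: S.reachable_induct)
    case (step x y)
    then have "(x, y) \<in> parcs (mk_symmetric Q)" by auto
    then have "Poly_Mapping.lookup f (vertex_path x) = Poly_Mapping.lookup f (vertex_path y)"
      using arc by (auto simp: parcs_mk_symmetric)
    then show ?case using step by simp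
  qed simp
qed

lemma verts_nonempty: "verts Q \<noteq> {}"
  using connected unfolding Digraph_Component.connected_def strongly_connected_def by auto

text \<open>Otherwise three nonnegative summands all vanish: the first kills the coefficients of
  longer paths, the second makes the vertex coefficients constant, the third makes that constant
  0.\<close>

lemma path_ip_pos:
  assumes f: "f \<in> path_algebra Q" and "f \<noteq> 0"
  shows "path_ip f f > 0"
proof (rule ccontr)
  define s1 where "s1 = (\<Sum>k\<in>long_paths. path_norm k * (Poly_Mapping.lookup f k * Poly_Mapping.lookup f k))"
  define s2 where "s2 = (\<Sum>k\<in>long_paths. weight_diff k f * weight_diff k f)"
  define s3 where "s3 = vertex_sum f * vertex_sum f"
  assume "\<not> path_ip f f > 0"
  then have "s1 + 2 * s2 + s3 \<le> 0" by (simp add: path_ip_def s1_def s2_def s3_def)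
  moreover have nn: "s1 \<ge> 0" "s2 \<ge> 0" "s3 \<ge> 0"
    unfolding s1_def s2_def s3_def using path_norm_pos[THEN less_imp_le]
    by (auto intro!: sum_nonneg)
  ultimately have "s1 = 0" "s2 = 0" "s3 = 0" by linarith+
  have long: "Poly_Mapping.lookup f k = 0" if "k \<in> long_paths" for k
  proof -
    have "path_norm k * (Poly_Mapping.lookup f k * Poly_Mapping.lookup f k) = 0"
      using \<open>s1 = 0\<close> that finite_long_paths path_norm_pos[THEN less_imp_le] unfolding s1_def
      by (subst (asm) sum_nonneg_eq_0_iff) auto
    then show ?thesis using path_norm_pos[of k] by simp
  qed
  have const: "weight_diff k f = 0" if "k \<in> long_paths" for k
    using \<open>s2 = 0\<close> that finite_long_paths unfolding s2_def
    by (subst (asm) sum_nonneg_eq_0_iff) auto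
  have vert: "Poly_Mapping.lookup f (vertex_path v) = 0" if "v \<in> verts Q" for v
  proof -
    have "vertex_sum f = (\<Sum>u\<in>verts Q. Poly_Mapping.lookup f (vertex_path v))"
      unfolding vertex_sum_def
      using that const by (intro sum.cong refl vertex_coefficients_constant) auto
    also have "\<dots> = card (verts Q) * Poly_Mapping.lookup f (vertex_path v)" by simp
    finally show ?thesis
      using \<open>s3 = 0\<close> verts_nonempty finite_verts by (simp add: s3_def)
  qed
  have "f = 0"
  proof (rule poly_mapping_eqI)
    fix k
    show "Poly_Mapping.lookup f k = Poly_Mapping.lookup 0 k"
    proof (cases "k \<in> quiver_paths Q")
      case True
      then show ?thesis using long[of k] vert unfolding quiver_paths_eq by auto
    next
      case False
      then show ?thesis using f by (auto simp: path_algebra_def in_keys_iff)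
    qed
  qed
  then show False using \<open>f \<noteq> 0\<close> by contradiction
qed

lemma inner_product_path_ip: "inner_product_within (path_algebra Q) path_ip"
proof -
  have "linear (\<lambda>f. path_ip f h)" for h
    using linear_path_ip[of h] by (simp add: path_ip_commute[of _ h])
  then show ?thesis
    unfolding inner_product_within_def bilinear_within_def
    using linear_path_ip path_ip_commute path_ip_pos by (blast intro: linear_within_if_linear)
qed

sublocale metric: metric_lie_algebra "path_algebra Q" path_bracket path_ip
proof -
  interpret lie_algebra_within "path_algebra Q" path_bracket by (rule lie_algebra_path_algebra)
  show "metric_lie_algebra (path_algebra Q) path_bracket path_ip"
    using finite_paths inner_product_path_ip
    by unfold_locales (auto simp: path_algebra_eq_span intro!: exI[of _ "basis_path ` quiver_paths Q"])
qed

section \<open>Orthogonality relations and brackets with vertices\<close>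

lemma basis_path_mem: "k \<in> quiver_paths Q \<Longrightarrow> basis_path k \<in> path_algebra Q"
  by (simp add: path_algebra_def)

lemma long_path_mem: "k \<in> long_paths \<Longrightarrow> basis_path k \<in> path_algebra Q"
  by (simp add: basis_path_mem long_paths_def)

lemma cartan_subset: "cartan \<subseteq> path_algebra Q"
  unfolding path_algebra_eq_span quiver_paths_eq by (rule span_mono) auto

lemma lookup_cartan:
  assumes "x \<in> cartan" "k \<in> long_paths"
  shows "Poly_Mapping.lookup x k = 0"
  using assms unfolding span_basis_path by (force simp: in_keys_iff)

lemma path_ip_long:
  assumes "k \<in> long_paths"
  shows "path_ip x (basis_path k) = path_norm k * Poly_Mapping.lookup x k"
proof -
  have "basis_path k \<in> in_degree_ge 1" using assms long_path_length by simp
  then have "path_ip x (basis_path k) =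
      (\<Sum>l\<in>long_paths. path_norm l * (Poly_Mapping.lookup x l * Poly_Mapping.lookup (basis_path k) l))"
    by (simp add: path_ip_def weight_diff_eq_0_if_degree vertex_sum_eq_0_if_degree)
  also have "\<dots> = (\<Sum>l\<in>long_paths. if k = l then path_norm l * Poly_Mapping.lookup x l else 0)"
    by (auto simp: lookup_single when_def intro!: sum.cong)
  also have "\<dots> = path_norm k * Poly_Mapping.lookup x k"
    using assms finite_long_paths by (simp add: sum.delta')
  finally show ?thesis .
qed

lemma path_ip_degree_cartan:
  assumes "x \<in> in_degree_ge 1" "y \<in> cartan"
  shows "path_ip x y = 0"
  using assms by (simp add: path_ip_def weight_diff_eq_0_if_degree vertex_sum_eq_0_if_degree lookup_cartan)

lemma path_bracket_vertices:
  "path_bracket (basis_path (vertex_path u)) (basis_path (vertex_path v)) = (0 :: ('v, 'e) qpath \<Rightarrow>\<^sub>0 real)"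
  by (simp add: path_bracket_def path_mult_basis)

lemma path_bracket_vertex_long:
  assumes "k \<in> quiver_paths Q"
  shows "path_bracket (basis_path (vertex_path v)) (basis_path k)
    = weight_diff k (basis_path (vertex_path v)) *\<^sub>R basis_path k"
  by (cases k) (simp add: path_bracket_def path_mult_basis weight_diff_def lookup_single when_def)

lemma path_bracket_cartan_long:
  assumes "x \<in> cartan" "k \<in> quiver_paths Q"
  shows "path_bracket x (basis_path k) = weight_diff k x *\<^sub>R basis_path k"
proof (rule linear_eq_on[where f = "\<lambda>x. path_bracket x (basis_path k)"])
  show "linear (\<lambda>x. weight_diff k x *\<^sub>R basis_path k)"
    by unfold_locales
      (simp_all add: linear_add[OF linear_weight_diff] linear_scale[OF linear_weight_diff] algebra_simps)
qed (use assms path_bracket_vertex_long[OF assms(2)] in \<open>auto intro: linear_path_bracket_left\<close>)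

lemma path_bracket_cartan:
  assumes "x \<in> cartan" "y \<in> cartan"
  shows "path_bracket x y = 0"
proof (rule linear_eq_on[where f = "path_bracket x" and g = "\<lambda>_. 0"])
  fix b :: "('v, 'e) qpath \<Rightarrow>\<^sub>0 real"
  assume "b \<in> basis_path ` vertex_path ` verts Q"
  then obtain v where v: "v \<in> verts Q" "b = basis_path (vertex_path v)" by auto
  \<comment> \<open>A vertex is itself a path with equal source and target, so its weight is
    0.\<close>
  then have "path_bracket x b = weight_diff (vertex_path v) x *\<^sub>R b"
    using assms(1) by (simp add: path_bracket_cartan_long quiver_paths_eq)
  then show "path_bracket x b = 0" by (simp add: weight_diff_def)
qed (use assms in \<open>auto intro: linear_path_bracket_right linear_zero\<close>)

text \<open>Vertices commute, and any other pair of paths has positive total length. Hence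
  commutators have no vertex component and are orthogonal to \<open>cartan\<close>.\<close>

lemma path_bracket_in_degree_1:
  assumes "x \<in> path_algebra Q" "y \<in> path_algebra Q"
  shows "path_bracket x y \<in> in_degree_ge 1"
proof -
  have basis: "path_bracket (basis_path k) (basis_path l) \<in> in_degree_ge 1"
    if "k \<in> quiver_paths Q" "l \<in> quiver_paths Q" for k l
  proof (cases "k \<in> long_paths \<or> l \<in> long_paths")
    case True
    then have "1 \<le> path_length k + path_length l" using long_path_length[of k] long_path_length[of l] by auto
    moreover have "path_bracket (basis_path k) (basis_path l) \<in> in_degree_ge (path_length k + path_length l)"
      by (intro path_bracket_degree) auto
    ultimately show ?thesis by (auto simp: in_degree_ge_def)
  next
    case False
    then show ?thesis
      using that path_bracket_vertices subspace_0[OF subspace_in_degree_ge]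
      unfolding quiver_paths_eq by auto
  qed
  have "path_bracket x (basis_path l) \<in> in_degree_ge 1" if "l \<in> quiver_paths Q" for l
    by (rule linear_mem_on_span_basis_path[OF linear_path_bracket_left subspace_in_degree_ge])
       (use basis that assms(1) in \<open>auto simp: path_algebra_eq_span\<close>)
  then show ?thesis
    by (rule linear_mem_on_span_basis_path[OF linear_path_bracket_right subspace_in_degree_ge])
       (use assms(2) in \<open>auto simp: path_algebra_eq_span\<close>)
qed

text \<open>Diagonal entry of ad x at \<open>k\<close>: a path of positive length in
  \<open>x\<close> only produces paths longer than \<open>k\<close>, so just the vertex part
  contributes, through its weight.\<close>

lemma lookup_path_bracket_long:
  assumes "x \<in> path_algebra Q" "k \<in> long_paths"
  shows "Poly_Mapping.lookup (path_bracket x (basis_path k)) k = weight_diff k x"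
proof (rule linear_eq_on[where f = "\<lambda>x. Poly_Mapping.lookup (path_bracket x (basis_path k)) k"
      and x = x and B = "basis_path ` quiver_paths Q"])
  show "linear (\<lambda>x. Poly_Mapping.lookup (path_bracket x (basis_path k)) k)"
    using linear_path_bracket_left[of "basis_path k"] by (simp add: linear_iff lookup_add)
  fix b assume "b \<in> basis_path ` quiver_paths Q"
  then obtain p where p: "b = basis_path p" "p \<in> quiver_paths Q" by auto
  show "Poly_Mapping.lookup (path_bracket b (basis_path k)) k = weight_diff k b"
  proof (cases "p \<in> long_paths")
    case True
    then have "path_bracket b (basis_path k) \<in> in_degree_ge (1 + path_length k)"
      using p long_path_length by (intro path_bracket_degree) auto
    moreover have "weight_diff k b = 0"
      using True p long_path_length by (intro weight_diff_eq_0_if_degree) auto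
    ultimately show ?thesis by (simp add: lookup_eq_0_if_degree)
  next
    case False
    then have "b \<in> cartan" using p unfolding quiver_paths_eq by (auto intro: span_base)
    then show ?thesis using assms(2) by (simp add: path_bracket_cartan_long long_paths_def)
  qed
qed (use assms in \<open>auto intro: linear_weight_diff simp: path_algebra_eq_span\<close>)

end

section \<open>Diagonal derivations\<close>

context acyclic_quiver
begin

definition arrow_sum :: "('e \<Rightarrow> real) \<Rightarrow> ('v, 'e) qpath \<Rightarrow> real" where
  "arrow_sum \<delta> k = sum_list (map \<delta> (fst (snd k)))"

definition identity :: "('v, 'e) qpath \<Rightarrow>\<^sub>0 real" where
  "identity = (\<Sum>v\<in>verts Q. basis_path (vertex_path v))"

definition diagonal :: "('e \<Rightarrow> real) \<Rightarrow> (('v, 'e) qpath \<Rightarrow>\<^sub>0 real) \<Rightarrow> (('v, 'e) qpath \<Rightarrow>\<^sub>0 real)" where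
  "diagonal \<delta> f = (\<Sum>k\<in>quiver_paths Q. (arrow_sum \<delta> k * Poly_Mapping.lookup f k) *\<^sub>R basis_path k)"

text \<open>The last summand maps into the center. It is needed because the Ricci operator
  vanishes on the identity of the path algebra instead of acting as \<open>-1/2\<close>.\<close>

definition soliton_derivation ::
    "('e \<Rightarrow> real) \<Rightarrow> (('v, 'e) qpath \<Rightarrow>\<^sub>0 real) \<Rightarrow> (('v, 'e) qpath \<Rightarrow>\<^sub>0 real)" where
  "soliton_derivation \<delta> f = diagonal \<delta> f + (vertex_sum f / (2 * card (verts Q))) *\<^sub>R identity"

lemma linear_diagonal: "linear (diagonal \<delta>)"
  by unfold_locales
     (simp_all add: diagonal_def lookup_add algebra_simps sum.distrib scaleR_sum_right)

lemma diagonal_basis_path: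
  assumes "k \<in> quiver_paths Q"
  shows "diagonal \<delta> (basis_path k) = arrow_sum \<delta> k *\<^sub>R basis_path k"
proof -
  have "diagonal \<delta> (basis_path k)
      = (\<Sum>l\<in>quiver_paths Q. if k = l then arrow_sum \<delta> l *\<^sub>R basis_path l else 0)"
    unfolding diagonal_def by (intro sum.cong) (auto simp: lookup_single when_def)
  then show ?thesis using assms finite_paths by (simp add: sum.delta')
qed

text \<open>The Leibniz rule on paths: sums over arrows add under concatenation, and paths that do
  not compose give 0 on both sides.\<close>

lemma diagonal_path_concat:
  assumes "k \<in> quiver_paths Q" "l \<in> quiver_paths Q"
  shows "diagonal \<delta> (path_concat k l) = (arrow_sum \<delta> k + arrow_sum \<delta> l) *\<^sub>R path_concat k l"
proof (cases "target k = source l")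
  case True
  then have eq: "path_concat k l = basis_path (source k, fst (snd k) @ fst (snd l), target l)"
    by (cases k; cases l) auto
  moreover have "(source k, fst (snd k) @ fst (snd l), target l) \<in> quiver_paths Q"
    using path_concat_in_path_algebra[OF assms] unfolding eq path_algebra_def by simp
  ultimately show ?thesis using diagonal_basis_path by (simp add: arrow_sum_def)
next
  case False
  then have "path_concat k l = 0" by (cases k; cases l) auto
  then show ?thesis using linear_0[OF linear_diagonal] by simp
qed

lemma identity_in_cartan: "identity \<in> cartan"
  unfolding identity_def by (intro span_sum span_base) auto

lemma identity_mem: "identity \<in> path_algebra Q"
  using identity_in_cartan cartan_subset by blast

lemma weight_diff_identity:
  assumes "k \<in> quiver_paths Q"
  shows "weight_diff k identity = 0"
proof -
  have "Poly_Mapping.lookup identity (vertex_path v) = 1" if "v \<in> verts Q" for v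
  proof -
    have "Poly_Mapping.lookup identity (vertex_path v) = (\<Sum>u\<in>verts Q. if u = v then 1 else 0)"
      unfolding identity_def lookup_sum by (intro sum.cong) (auto simp: lookup_single when_def)
    then show ?thesis using that by simp
  qed
  then show ?thesis using source_target_in_verts[OF assms] by (simp add: weight_diff_def)
qed

text \<open>All vertex coefficients of \<open>identity\<close> are 1, so every path has weight 0 on
  it.\<close>

lemma identity_central:
  assumes "x \<in> path_algebra Q"
  shows "path_bracket identity x = 0"
proof (rule linear_eq_on[where f = "path_bracket identity" and g = "\<lambda>_. 0" and B = "basis_path ` quiver_paths Q"])
  fix b assume "b \<in> basis_path ` quiver_paths Q"
  then show "path_bracket identity b = 0"
    using path_bracket_cartan_long[OF identity_in_cartan] weight_diff_identity by auto
qed (use assms in \<open>auto simp: path_algebra_eq_span intro: linear_path_bracket_right linear_zero\<close>)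

text \<open>Only the last summand of \<open>path_ip\<close> sees \<open>identity\<close>. The factor
  \<open>card (verts Q)\<close> is the origin of the denominator in
  \<open>soliton_derivation\<close>.\<close>

lemma path_ip_identity: "path_ip identity x = card (verts Q) * vertex_sum x"
proof -
  have "vertex_sum identity = (\<Sum>v\<in>verts Q. vertex_sum (basis_path (vertex_path v)))"
    unfolding identity_def by (rule linear_sum[OF linear_vertex_sum])
  also have "\<dots> = (\<Sum>v\<in>verts Q. 1)"
  proof (rule sum.cong[OF refl])
    fix v assume "v \<in> verts Q"
    moreover have "vertex_sum (basis_path (vertex_path v)) = (\<Sum>u\<in>verts Q. if v = u then 1 else 0)"
      unfolding vertex_sum_def by (intro sum.cong) (auto simp: lookup_single when_def)
    ultimately show "vertex_sum (basis_path (vertex_path v)) = 1" by simp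
  qed
  finally show ?thesis
    using weight_diff_identity lookup_cartan[OF identity_in_cartan]
    by (simp add: path_ip_def long_paths_def)
qed

lemma linear_soliton_derivation: "linear (soliton_derivation \<delta>)"
  by unfold_locales
     (simp_all add: soliton_derivation_def linear_add[OF linear_diagonal] linear_scale[OF linear_diagonal]
       linear_add[OF linear_vertex_sum] linear_scale[OF linear_vertex_sum] add_divide_distrib algebra_simps)

lemma soliton_derivation_mem: "soliton_derivation \<delta> f \<in> path_algebra Q"
proof -
  have "diagonal \<delta> f \<in> path_algebra Q"
    unfolding diagonal_def
    by (intro subspace_sum[OF subspace_path_algebra] subspace_scale[OF subspace_path_algebra] basis_path_mem)
  then show ?thesis
    unfolding soliton_derivation_def
    by (intro subspace_add[OF subspace_path_algebra] subspace_scale[OF subspace_path_algebra] identity_mem)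
qed

text \<open>The diagonal part satisfies the Leibniz rule on pairs of paths and hence everywhere. For
  the other part both sides are 0: \<open>vertex_sum\<close> vanishes on commutators, and
  \<open>identity\<close> is central.\<close>

lemma derivation_soliton_derivation: "metric.derivation (soliton_derivation \<delta>)"
  unfolding metric.derivation_def
proof (intro conjI ballI)
  show "soliton_derivation \<delta> ` path_algebra Q \<subseteq> path_algebra Q"
    using soliton_derivation_mem by auto
  show "linear_within (path_algebra Q) (soliton_derivation \<delta>)"
    by (rule linear_within_if_linear[OF linear_soliton_derivation])
  fix x y assume x: "x \<in> path_algebra Q" and y: "y \<in> path_algebra Q"
  let ?R = "\<lambda>x y. path_bracket (diagonal \<delta> x) y + path_bracket x (diagonal \<delta> y)"
  have lin: "linear (\<lambda>x. diagonal \<delta> (path_bracket x y))" "linear (\<lambda>y. diagonal \<delta> (path_bracket x y))"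
     "linear (\<lambda>x. ?R x y)" "linear (\<lambda>y. ?R x y)" for x y
    using linear_compose[OF linear_path_bracket_left linear_diagonal]
      linear_compose[OF linear_path_bracket_right linear_diagonal]
      linear_compose[OF linear_diagonal linear_path_bracket_left]
      linear_compose[OF linear_diagonal linear_path_bracket_right]
    by (auto simp: o_def intro!: linear_compose_add linear_path_bracket_left linear_path_bracket_right)
  have basis: "diagonal \<delta> (path_bracket (basis_path k) (basis_path l)) = ?R (basis_path k) (basis_path l)"
    if k: "k \<in> quiver_paths Q" and l: "l \<in> quiver_paths Q" for k l
  proof -
    have "diagonal \<delta> (path_bracket (basis_path k) (basis_path l))
      = (arrow_sum \<delta> k + arrow_sum \<delta> l) *\<^sub>R path_bracket (basis_path k) (basis_path l)"
      using k l by (simp add: path_bracket_def path_mult_basis linear_diff[OF linear_diagonal]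
          diagonal_path_concat algebra_simps)
    also have "\<dots> = ?R (basis_path k) (basis_path l)"
      using k l by (simp add: diagonal_basis_path linear_scale[OF linear_path_bracket_left]
          linear_scale[OF linear_path_bracket_right] scaleR_add_left)
    finally show ?thesis .
  qed
  have "diagonal \<delta> (path_bracket x (basis_path l)) = ?R x (basis_path l)" if "l \<in> quiver_paths Q" for l
    by (rule linear_eq_on[OF lin(1) lin(3), where B = "basis_path ` quiver_paths Q"])
       (use x basis[OF _ that] in \<open>auto simp: path_algebra_eq_span\<close>)
  then have "diagonal \<delta> (path_bracket x b) = ?R x b" if "b \<in> basis_path ` quiver_paths Q" for b
    using that by blast
  then have diag: "diagonal \<delta> (path_bracket x y) = ?R x y"
    using linear_eq_on[OF lin(2) lin(4), of y "basis_path ` quiver_paths Q" x x] y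
    unfolding path_algebra_eq_span by blast
  have "vertex_sum (path_bracket x y) = 0"
    using x y by (intro vertex_sum_eq_0_if_degree path_bracket_in_degree_1)
  moreover have "path_bracket x identity = 0"
    using identity_central[OF x] by (simp add: path_bracket_def)
  ultimately show "soliton_derivation \<delta> (path_bracket x y)
      = path_bracket (soliton_derivation \<delta> x) y + path_bracket x (soliton_derivation \<delta> y)"
    using diag identity_central[OF y]
    by (simp add: soliton_derivation_def linear_add[OF linear_path_bracket_left]
        linear_add[OF linear_path_bracket_right] linear_scale[OF linear_path_bracket_left]
        linear_scale[OF linear_path_bracket_right])
qed

end

section \<open>The Ricci form of the path algebra\<close>

context acyclic_quiver
begin

definition unit_path :: "('v, 'e) qpath \<Rightarrow> ('v, 'e) qpath \<Rightarrow>\<^sub>0 real" where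
  "unit_path k = (1 / sqrt (path_norm k)) *\<^sub>R basis_path k"

lemma unit_path_mem: "k \<in> long_paths \<Longrightarrow> unit_path k \<in> path_algebra Q"
  unfolding unit_path_def by (intro subspace_scale[OF subspace_path_algebra] long_path_mem)

lemma path_ip_unit_path:
  assumes "k \<in> long_paths"
  shows "path_ip x (unit_path k) = sqrt (path_norm k) * Poly_Mapping.lookup x k"
  using path_ip_long[OF assms, of x] path_norm_pos[of k]
  by (simp add: unit_path_def linear_scale[OF linear_path_ip] real_div_sqrt field_simps flip: power2_eq_square)

text \<open>Vertices need not be orthogonal to each other for \<open>path_ip\<close>, so this part
  of the frame comes from Gram-Schmidt. Its explicit form is irrelevant, since sums over it cancel
  in the Ricci form.\<close>

lemma ex_cartan_basis: "\<exists>A. metric.orthonormal A \<and> span A = cartan"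
  using cartan_subset span_superset
  by (intro metric.gram_schmidt finite_imageI finite_verts) (blast intro: span_base)

context
  fixes A assumes A: "metric.orthonormal A" "span A = cartan"
begin

lemma A_cartan: "a \<in> A \<Longrightarrow> a \<in> cartan"
  using A(2) span_base by blast

lemma A_mem: "a \<in> A \<Longrightarrow> a \<in> path_algebra Q"
  using A_cartan cartan_subset by blast

lemma orthonormal_basis:
  "metric.orthonormal (A \<union> unit_path ` long_paths)" "span (A \<union> unit_path ` long_paths) = path_algebra Q"
proof -
  have A': "finite A" "A \<subseteq> path_algebra Q" "\<And>e f. e \<in> A \<Longrightarrow> f \<in> A \<Longrightarrow> path_ip e f = (if e = f then 1 else 0)"
    using A(1) by (auto simp: metric.orthonormal_def)
  have inter: "path_ip a (unit_path k) = 0" "path_ip (unit_path k) a = 0" if "a \<in> A" "k \<in> long_paths" for a k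
    using that A_cartan[of a] path_ip_commute[of a "unit_path k"] by (simp_all add: path_ip_unit_path lookup_cartan)
  have units: "path_ip (unit_path k) (unit_path l) = (if k = l then 1 else 0)" if "k \<in> long_paths" "l \<in> long_paths" for k l
    using that path_norm_pos[of k] by (auto simp: path_ip_unit_path) (auto simp: unit_path_def lookup_single when_def)
  have neq: "a \<noteq> unit_path k" if "a \<in> A" "k \<in> long_paths" for a k
    using inter[OF that] units[OF that(2,2)] by auto
  \<comment> \<open>Orthonormality speaks of equal vectors, not equal indices; distinct paths with
    the same unit vector would have inner product both 0 and 1.\<close>
  have units': "path_ip (unit_path k) (unit_path l) = (if unit_path k = unit_path l then 1 else 0)"
    if "k \<in> long_paths" "l \<in> long_paths" for k l
    using units[OF that] units[OF that(1,1)] by (cases "k = l") auto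
  show "metric.orthonormal (A \<union> unit_path ` long_paths)"
    unfolding metric.orthonormal_def
  proof (intro conjI ballI)
    show "finite (A \<union> unit_path ` long_paths)" using A'(1) finite_long_paths by simp
    show "A \<union> unit_path ` long_paths \<subseteq> path_algebra Q" using A'(2) unit_path_mem by auto
    fix e f assume "e \<in> A \<union> unit_path ` long_paths" "f \<in> A \<union> unit_path ` long_paths"
    then show "path_ip e f = (if e = f then 1 else 0)"
    proof (elim UnE imageE)
      fix k l assume "e = unit_path k" "k \<in> long_paths" "f = unit_path l" "l \<in> long_paths"
      then show ?thesis using units'[of k l] by simp
    next
      fix k assume "e = unit_path k" "k \<in> long_paths" "f \<in> A"
      then show ?thesis using inter[of f k] neq[of f k] by auto
    next
      fix k assume "f = unit_path k" "k \<in> long_paths" "e \<in> A"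
      then show ?thesis using inter[of e k] neq[of e k] by auto
    qed (use A'(3) in auto)
  qed
  show "span (A \<union> unit_path ` long_paths) = path_algebra Q"
  proof
    show "span (A \<union> unit_path ` long_paths) \<subseteq> path_algebra Q"
      using A'(2) unit_path_mem subspace_path_algebra by (intro span_minimal) auto
    have "basis_path k \<in> span (A \<union> unit_path ` long_paths)" if "k \<in> quiver_paths Q" for k
    proof (cases "k \<in> long_paths")
      case True
      then have "sqrt (path_norm k) *\<^sub>R unit_path k \<in> span (A \<union> unit_path ` long_paths)"
        by (intro span_scale span_base) auto
      then show ?thesis using path_norm_pos[of k] by (simp add: unit_path_def)
    next
      case False
      then have "basis_path k \<in> span A" unfolding A(2) using that quiver_paths_eq by (auto intro: span_base)
      then show ?thesis using span_mono[of A "A \<union> unit_path ` long_paths"] by blast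
    qed
    then show "path_algebra Q \<subseteq> span (A \<union> unit_path ` long_paths)"
      unfolding path_algebra_eq_span by (intro span_minimal) auto
  qed
qed

lemma sum_orthonormal_basis:
  "(\<Sum>e\<in>A \<union> unit_path ` long_paths. F e) = (\<Sum>a\<in>A. F a) + (\<Sum>k\<in>long_paths. F (unit_path k))"
proof -
  have ip1: "path_ip (unit_path k) (unit_path k) = 1" if "k \<in> long_paths" for k
    using orthonormal_basis(1) that unfolding metric.orthonormal_def by auto
  have "k = l" if "k \<in> long_paths" "l \<in> long_paths" "unit_path k = unit_path l" for k l
  proof (rule ccontr)
    assume "k \<noteq> l"
    then have "path_ip (unit_path k) (unit_path l) = 0"
      using that(2) by (simp add: path_ip_unit_path) (simp add: unit_path_def lookup_single when_def)
    then show False using ip1[OF that(1)] that(3) by simp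
  qed
  then have "inj_on unit_path long_paths" by (auto intro: inj_onI)
  moreover have "A \<inter> unit_path ` long_paths = {}"
  proof -
    have "path_ip a (unit_path k) = 0" if "a \<in> A" "k \<in> long_paths" for a k
      using that A_cartan[of a] by (simp add: path_ip_unit_path lookup_cartan)
    with ip1 show ?thesis by force
  qed
  moreover have "finite A" using A(1) by (simp add: metric.orthonormal_def)
  ultimately show ?thesis using finite_long_paths by (simp add: sum.union_disjoint sum.reindex)
qed

end

end

section \<open>Brackets between paths of positive length\<close>

context acyclic_quiver
begin

lemma awalk_head_last: "awalk u p v \<Longrightarrow> p \<noteq> [] \<Longrightarrow> head Q (last p) = v"
  by (induction p arbitrary: u) (auto simp: awalk_Cons_iff awalk_Nil_iff)

text \<open>Concatenation as a triple instead of a vector; it is total, and describes a walk of the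
  quiver when two composable paths are joined.\<close>

definition join :: "('v, 'e) qpath \<Rightarrow> ('v, 'e) qpath \<Rightarrow> ('v, 'e) qpath" where
  "join k l = (source k, fst (snd k) @ fst (snd l), target l)"

lemma join_simps [simp]:
  "source (join k l) = source k" "target (join k l) = target l"
  by (simp_all add: join_def)

lemma path_concat_join:
  "path_concat k l = (if target k = source l then basis_path (join k l) else 0)"
  by (cases k; cases l) (simp add: join_def)

lemma join_long:
  assumes "k \<in> long_paths" "l \<in> long_paths" "target k = source l"
  shows "join k l \<in> long_paths"
  using assms awalk_appendI
  by (cases k; cases l) (auto simp: join_def long_paths_def quiver_paths_def)

text \<open>The meeting vertex is the head of the last arrow of \<open>k\<close>, which
  \<open>interior k\<close> omits but which becomes interior in the joined path.\<close>

lemma interior_join: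
  assumes "k \<in> long_paths" "l \<in> long_paths"
  shows "interior (join k l) = interior k @ target k # interior l"
proof -
  obtain u p v where k: "k = (u, p, v)" by (cases k)
  have p: "awalk u p v" "p \<noteq> []" using assms(1) k by (auto simp: long_paths_def quiver_paths_def)
  have l: "fst (snd l) \<noteq> []" using assms(2) by (auto simp: long_paths_def)
  have "butlast (p @ fst (snd l)) = butlast p @ last p # butlast (fst (snd l))"
    using p(2) l by (simp add: butlast_append)
  then show ?thesis using awalk_head_last[OF p] k by (simp add: interior_def join_def)
qed

lemma path_norm_join:
  assumes "k \<in> long_paths" "l \<in> long_paths"
  shows "path_norm (join k l) = path_norm k * vertex_weight (target k) * path_norm l"
  using assms by (simp add: path_norm_def interior_join)

definition splittings :: "('v, 'e) qpath \<Rightarrow> (('v, 'e) qpath \<times> ('v, 'e) qpath) set" where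
  "splittings p = {(k, l) \<in> long_paths \<times> long_paths. target k = source l \<and> join k l = p}"

text \<open>Cutting \<open>p\<close> at an interior position is a bijection onto its splittings, and
  the vertex at the cut is the common endpoint of the two pieces.\<close>

lemma sum_splittings:
  assumes "p \<in> long_paths"
  shows "(\<Sum>(k, l)\<in>splittings p. f (target k)) = sum_list (map f (interior p))"
proof -
  obtain u as v where p: "p = (u, as, v)" by (cases p)
  have walk: "awalk u as v" "as \<noteq> []" using assms p by (auto simp: long_paths_def quiver_paths_def)
  let ?m = "\<lambda>i. head Q (as ! i)"
  \<comment> \<open>Index \<open>i\<close> cuts after arrow \<open>i\<close>, so the first piece has
    length \<open>Suc i\<close>; both pieces are nonempty exactly when
    \<open>i < length as - 1\<close>.\<close>
  let ?split = "\<lambda>i. ((u, take (Suc i) as, ?m i), (?m i, drop (Suc i) as, v))"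
  have split_walk: "awalk u (take (Suc i) as) (?m i)" "awalk (?m i) (drop (Suc i) as) v"
    if "i < length as" for i
  proof -
    have "awalk u (take (Suc i) as @ drop (Suc i) as) v" using walk by simp
    then obtain w where w: "awalk u (take (Suc i) as) w" "awalk w (drop (Suc i) as) v"
      unfolding awalk_append_iff by blast
    have "take (Suc i) as \<noteq> []" using that by auto
    with w(1) have "head Q (last (take (Suc i) as)) = w" by (rule awalk_head_last)
    moreover have "last (take (Suc i) as) = as ! i" using that by (simp add: take_Suc_conv_app_nth)
    ultimately show "awalk u (take (Suc i) as) (?m i)" "awalk (?m i) (drop (Suc i) as) v" using w by auto
  qed
  have "(\<Sum>(k, l)\<in>splittings p. f (target k)) = (\<Sum>i\<in>{0..<length as - 1}. f (?m i))"
  proof (rule sum.reindex_bij_witness[where i = ?split and j = "\<lambda>(k, l). path_length k - 1"])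
    fix i assume i: "i \<in> {0..<length as - 1}"
    then have "i < length as" by simp
    note w = split_walk[OF this]
    show "?split i \<in> splittings p"
      using i w walk(2) by (auto simp: splittings_def long_paths_def quiver_paths_def join_def p)
    show "(case ?split i of (k, l) \<Rightarrow> path_length k - 1) = i" using i by simp
  next
    fix kl assume "kl \<in> splittings p"
    then obtain k l where kl: "kl = (k, l)" "k \<in> long_paths" "l \<in> long_paths" "target k = source l" "join k l = p"
      by (auto simp: splittings_def)
    obtain q w where k: "k = (u, q, w)" using kl(5) p by (cases k) (auto simp: join_def)
    obtain r where l: "l = (w, r, v)" using kl(4,5) p k by (cases l) (auto simp: join_def)
    have as: "as = q @ r" using kl(5) p k l by (simp add: join_def)
    have q: "awalk u q w" "q \<noteq> []" and r: "r \<noteq> []"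
      using kl(2,3) k l by (auto simp: long_paths_def quiver_paths_def)
    have "as ! (length q - 1) = last q" using as q(2) by (simp add: nth_append last_conv_nth)
    then have m: "?m (length q - 1) = w" using awalk_head_last[OF q] by simp
    show "(case kl of (k, l) \<Rightarrow> path_length k - 1) \<in> {0..<length as - 1}"
      using kl(1) k as q(2) r by (cases q; cases r) auto
    show "?split (case kl of (k, l) \<Rightarrow> path_length k - 1) = kl"
      using kl(1) m k l as q(2) by simp
    show "f (?m (case kl of (k, l) \<Rightarrow> path_length k - 1)) = (case kl of (k, l) \<Rightarrow> f (target k))"
      using kl(1) m k by simp
  qed
  also have "\<dots> = sum_list (map f (interior p))"
    unfolding sum_list_sum_nth by (intro sum.cong) (auto simp: interior_def p nth_butlast)
  finally show ?thesis .
qed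

lemma path_bracket_long:
  assumes "k \<in> long_paths" "l \<in> long_paths"
  shows "path_bracket (basis_path k) (basis_path l) =
    (if target k = source l then basis_path (join k l)
     else if target l = source k then - basis_path (join l k) else 0)"
proof -
  \<comment> \<open>If both orders were composable, \<open>join k l\<close> would be a cycle of
    positive length.\<close>
  have False if "target k = source l" "target l = source k"
    using source_neq_target[OF join_long[OF assms that(1)]] that by simp
  then show ?thesis by (auto simp: path_bracket_def path_mult_basis path_concat_join)
qed

lemma lookup_path_bracket_long_product:
  assumes "k \<in> long_paths" "l \<in> long_paths"
  shows "Poly_Mapping.lookup (path_bracket (basis_path k) (basis_path l)) p *
      Poly_Mapping.lookup (path_bracket (basis_path k) (basis_path l)) q =
    (if p = q then (if (k, l) \<in> splittings p then 1 else 0) + (if (l, k) \<in> splittings p then 1 else 0) else 0)"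
proof -
  \<comment> \<open>By acyclicity at most one of \<open>kl\<close> and \<open>lk\<close> is a path, so no cross terms appear.\<close>
  have no: False if "target k = source l" "target l = source k"
    using source_neq_target[OF join_long[OF assms that(1)]] that by simp
  show ?thesis
  proof (cases "target k = source l")
    case True
    then have "target l \<noteq> source k" using no by auto
    with True show ?thesis using assms
      by (auto simp: path_bracket_long splittings_def lookup_single when_def)
  next
    case False
    then show ?thesis using assms
      by (auto simp: path_bracket_long splittings_def lookup_single when_def)
  qed
qed

lemma path_ip_long_long:
  assumes "k \<in> long_paths" "l \<in> long_paths"
  shows "path_ip (basis_path k) (basis_path l) = (if k = l then path_norm k else 0)"
  using assms by (simp add: path_ip_long lookup_single when_def)

lemma join_cancel:
  "target p = source k \<Longrightarrow> target q = source k \<Longrightarrow> join p k = join q k \<Longrightarrow> p = q"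
  "target k = source p \<Longrightarrow> target k = source q \<Longrightarrow> join k p = join k q \<Longrightarrow> p = q"
  by (cases p; cases q; cases k; simp add: join_def)+

lemma path_ip_minus: "path_ip (- f) h = - path_ip f h" "path_ip f (- h) = - path_ip f h"
  using linear_neg[OF linear_path_ip] path_ip_commute by metis+

text \<open>For \<open>p = q\<close> the bracket is up to sign one joined path, whose squared norm
  factors. For distinct \<open>p\<close>, \<open>q\<close> the joined paths differ, either by
  cancelling \<open>k\<close> or because equality would close a cycle.\<close>

lemma path_ip_bracket_long:
  assumes p: "p \<in> long_paths" and q: "q \<in> long_paths" and k: "k \<in> long_paths"
  shows "path_ip (path_bracket (basis_path p) (basis_path k)) (path_bracket (basis_path q) (basis_path k)) =
    (if p = q then path_norm p * path_norm k *
      ((if target p = source k then vertex_weight (target p) else 0)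
        + (if target k = source p then vertex_weight (source p) else 0)) else 0)"
proof (cases "p = q")
  case True
  have no: False if "target p = source k" "target k = source p"
    using source_neq_target[OF join_long[OF p k that(1)]] that by simp
  show ?thesis
  proof (cases "target p = source k")
    case t: True
    then have "target k \<noteq> source p" using no by auto
    with t True show ?thesis
      using p k join_long[OF p k t] by (simp add: path_bracket_long path_ip_long_long path_norm_join)
  next
    case f: False
    then show ?thesis
      using True p k join_long[OF k p]
      by (simp add: path_bracket_long path_ip_long_long path_norm_join path_ip_minus
          linear_0[OF linear_path_ip])
  qed
next
  case False
  have 1: "join p k \<noteq> join q k" if "target p = source k" "target q = source k"
    using that join_cancel(1)[of p k q] False by blast
  have 2: "join k p \<noteq> join k q" if "target k = source p" "target k = source q"
    using that join_cancel(2)[of k p q] False by blast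
  \<comment> \<open>Equal joins have equal sources, so \<open>p\<close> would start at the source of
    \<open>k\<close>, which is its own target.\<close>
  have 3: "join p k \<noteq> join k q" if "target p = source k"
    using that source_neq_target[OF p] by (metis join_simps(1))
  have 4: "join k p \<noteq> join q k" if "target q = source k"
    using that source_neq_target[OF q] by (metis join_simps(1))
  show ?thesis
    using p q k False 1 2 3 4 join_long
    by (auto simp: path_bracket_long path_ip_long_long path_ip_minus linear_0[OF linear_path_ip]
        path_ip_commute[of 0])
qed

text \<open>After normalising by \<open>path_norm k\<close>, each path leaving the target of
  \<open>p\<close> contributes the same amount, whatever its length, and likewise each path entering
  the source. This is how the two counts arise.\<close>

lemma sum_path_ip_bracket_long:
  assumes p: "p \<in> long_paths" and q: "q \<in> long_paths"
  shows "(\<Sum>k\<in>long_paths. path_ip (path_bracket (basis_path p) (basis_path k))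
        (path_bracket (basis_path q) (basis_path k)) / path_norm k) =
    (if p = q then path_norm p * (vertex_weight (target p) * out_count (target p)
      + vertex_weight (source p) * in_count (source p)) else 0)"
proof -
  have "(\<Sum>k\<in>long_paths. path_ip (path_bracket (basis_path p) (basis_path k))
        (path_bracket (basis_path q) (basis_path k)) / path_norm k)
    = (\<Sum>k\<in>long_paths. (if p = q then path_norm p else 0) *
      ((if source k = target p then vertex_weight (target p) else 0)
        + (if target k = source p then vertex_weight (source p) else 0)))"
  proof (rule sum.cong[OF refl])
    fix k assume "k \<in> long_paths"
    then show "path_ip (path_bracket (basis_path p) (basis_path k))
        (path_bracket (basis_path q) (basis_path k)) / path_norm k
      = (if p = q then path_norm p else 0) *
      ((if source k = target p then vertex_weight (target p) else 0)
        + (if target k = source p then vertex_weight (source p) else 0))"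
      using path_ip_bracket_long[OF p q, of k] path_norm_pos[of k] by auto
  qed
  also have "\<dots> = (if p = q then path_norm p else 0) *
      ((\<Sum>k\<in>long_paths. if source k = target p then vertex_weight (target p) else 0)
        + (\<Sum>k\<in>long_paths. if target k = source p then vertex_weight (source p) else 0))"
    by (simp only: sum_distrib_left sum.distrib distrib_left)
  also have "(\<Sum>k\<in>long_paths. if source k = target p then vertex_weight (target p) else 0)
      = vertex_weight (target p) * out_count (target p)"
    using finite_long_paths by (simp add: out_count_def flip: sum.inter_filter)
  also have "(\<Sum>k\<in>long_paths. if target k = source p then vertex_weight (source p) else 0)
      = vertex_weight (source p) * in_count (source p)"
    using finite_long_paths by (simp add: in_count_def flip: sum.inter_filter)
  finally show ?thesis by simp
qed

text \<open>A splitting at \<open>v\<close> contributes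
  \<open>1 / (path_norm k * path_norm l)\<close>, which is
  \<open>vertex_weight v / path_norm p\<close>. The factor 2 counts each splitting in both orders of
  the summation indices.\<close>

lemma sum_lookup_path_bracket_long:
  assumes p: "p \<in> long_paths"
  shows "(\<Sum>k\<in>long_paths. \<Sum>l\<in>long_paths.
      Poly_Mapping.lookup (path_bracket (basis_path k) (basis_path l)) p *
      Poly_Mapping.lookup (path_bracket (basis_path k) (basis_path l)) q / (path_norm k * path_norm l)) =
    (if p = q then 2 * sum_list (map vertex_weight (interior p)) / path_norm p else 0)"
proof -
  let ?t = "\<lambda>k l. if (k, l) \<in> splittings p then 1 / (path_norm k * path_norm l) else 0"
  have "(\<Sum>k\<in>long_paths. \<Sum>l\<in>long_paths.
      Poly_Mapping.lookup (path_bracket (basis_path k) (basis_path l)) p *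
      Poly_Mapping.lookup (path_bracket (basis_path k) (basis_path l)) q / (path_norm k * path_norm l))
    = (\<Sum>k\<in>long_paths. \<Sum>l\<in>long_paths. (if p = q then 1 else 0) * (?t k l + ?t l k))"
  proof (intro sum.cong refl)
    fix k l assume kl: "k \<in> long_paths" "l \<in> long_paths"
    show "Poly_Mapping.lookup (path_bracket (basis_path k) (basis_path l)) p *
      Poly_Mapping.lookup (path_bracket (basis_path k) (basis_path l)) q / (path_norm k * path_norm l)
      = (if p = q then 1 else 0) * (?t k l + ?t l k)"
      unfolding lookup_path_bracket_long_product[OF kl]
      by (auto simp: mult.commute add_divide_distrib)
  qed
  also have "\<dots> = (if p = q then 1 else 0) *
      ((\<Sum>k\<in>long_paths. \<Sum>l\<in>long_paths. ?t k l) + (\<Sum>k\<in>long_paths. \<Sum>l\<in>long_paths. ?t l k))"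
    by (simp only: sum_distrib_left sum.distrib distrib_left)
  also have "(\<Sum>k\<in>long_paths. \<Sum>l\<in>long_paths. ?t l k) = (\<Sum>k\<in>long_paths. \<Sum>l\<in>long_paths. ?t k l)"
    by (rule sum.swap)
  also have "(\<Sum>k\<in>long_paths. \<Sum>l\<in>long_paths. ?t k l)
      = (\<Sum>kl\<in>long_paths \<times> long_paths. if kl \<in> splittings p then 1 / (path_norm (fst kl) * path_norm (snd kl)) else 0)"
    by (subst sum.cartesian_product) (simp add: case_prod_unfold)
  also have "\<dots> = (\<Sum>kl\<in>splittings p. 1 / (path_norm (fst kl) * path_norm (snd kl)))"
    using finite_long_paths
    by (intro sum.mono_neutral_cong_right) (auto simp: splittings_def)
  also have "\<dots> = (\<Sum>(k, l)\<in>splittings p. vertex_weight (target k) / path_norm p)"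
  proof (intro sum.cong refl)
    fix kl assume "kl \<in> splittings p"
    then obtain k l where kl: "kl = (k, l)" "k \<in> long_paths" "l \<in> long_paths" "join k l = p"
      by (auto simp: splittings_def)
    have "path_norm p = path_norm k * vertex_weight (target k) * path_norm l"
      using path_norm_join[OF kl(2,3)] kl(4) by simp
    then show "1 / (path_norm (fst kl) * path_norm (snd kl))
        = (case kl of (k, l) \<Rightarrow> vertex_weight (target k) / path_norm p)"
      using kl(1) vertex_weight_pos[of "target k"] by simp
  qed
  also have "\<dots> = (\<Sum>(k, l)\<in>splittings p. vertex_weight (target k)) / path_norm p"
    by (simp add: sum_divide_distrib case_prod_unfold)
  also have "(\<Sum>(k, l)\<in>splittings p. vertex_weight (target k)) = sum_list (map vertex_weight (interior p))"
    using p by (rule sum_splittings)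
  finally show ?thesis by simp
qed

end

section \<open>Evaluation of the Ricci form and the soliton equation\<close>

context acyclic_quiver
begin

lemma degree_0 [simp]: "f \<in> in_degree_ge 0"
  by (simp add: in_degree_ge_def)

lemma path_ip_0 [simp]: "path_ip 0 x = 0" "path_ip x 0 = 0"
  using linear_0[OF linear_path_ip] path_ip_commute by metis+

lemma path_ip_scale: "path_ip (c *\<^sub>R f) h = c * path_ip f h" "path_ip f (c *\<^sub>R h) = c * path_ip f h"
  using linear_scale[OF linear_path_ip] path_ip_commute by (metis real_scaleR_def)+

lemma path_ip_add_left: "path_ip (f + f') h = path_ip f h + path_ip f' h"
  using linear_add[OF linear_path_ip] path_ip_commute by metis

lemma path_bracket_anticommute: "path_bracket x y = - path_bracket y x"
  by (simp add: path_bracket_def)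

lemma path_bracket_scale:
  "path_bracket (c *\<^sub>R x) y = c *\<^sub>R path_bracket x y" "path_bracket x (c *\<^sub>R y) = c *\<^sub>R path_bracket x y"
  using linear_scale[OF linear_path_bracket_left] linear_scale[OF linear_path_bracket_right] by auto

lemma path_bracket_0 [simp]: "path_bracket 0 y = 0" "path_bracket x 0 = 0"
  using linear_0[OF linear_path_bracket_left] linear_0[OF linear_path_bracket_right] by auto

lemma inverse_sqrt_path_norm: "1 / sqrt (path_norm k) * (1 / sqrt (path_norm k)) = 1 / path_norm k"
  using path_norm_pos[of k] by simp

lemma path_ip_unit_bracket:
  "path_ip (path_bracket x (unit_path k)) (path_bracket y (unit_path k)) =
    path_ip (path_bracket x (basis_path k)) (path_bracket y (basis_path k)) / path_norm k"
  using inverse_sqrt_path_norm[of k]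
  by (simp add: unit_path_def path_bracket_scale path_ip_scale)

lemma lookup_unit_unit_bracket:
  "Poly_Mapping.lookup (path_bracket (unit_path k) (unit_path l)) p *
      Poly_Mapping.lookup (path_bracket (unit_path k) (unit_path l)) q =
    Poly_Mapping.lookup (path_bracket (basis_path k) (basis_path l)) p *
      Poly_Mapping.lookup (path_bracket (basis_path k) (basis_path l)) q / (path_norm k * path_norm l)"
proof -
  have rearrange: "a * (b * c) * (a * (b * d)) = c * d * (b * b * (a * a))" for a b c d :: real
    by (simp add: mult_ac)
  have "Poly_Mapping.lookup (path_bracket (unit_path k) (unit_path l)) p *
      Poly_Mapping.lookup (path_bracket (unit_path k) (unit_path l)) q =
    Poly_Mapping.lookup (path_bracket (basis_path k) (basis_path l)) p *
      Poly_Mapping.lookup (path_bracket (basis_path k) (basis_path l)) q *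
      ((1 / sqrt (path_norm k) * (1 / sqrt (path_norm k))) * (1 / sqrt (path_norm l) * (1 / sqrt (path_norm l))))"
    unfolding unit_path_def path_bracket_scale lookup_scaleR real_scaleR_def by (rule rearrange)
  then show ?thesis unfolding inverse_sqrt_path_norm by simp
qed

text \<open>Diagonal entries of ad x ad y: a vertex combination \<open>y\<close> first rescales
  \<open>k\<close> by its weight, whereas \<open>y\<close> of positive degree lengthens
  \<open>k\<close> irrevocably.\<close>

lemma lookup_path_bracket_bracket:
  assumes x: "x \<in> path_algebra Q" and k: "k \<in> long_paths"
  shows "y \<in> cartan \<Longrightarrow>
      Poly_Mapping.lookup (path_bracket x (path_bracket y (basis_path k))) k = weight_diff k y * weight_diff k x"
    and "y \<in> in_degree_ge 1 \<Longrightarrow>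
      Poly_Mapping.lookup (path_bracket x (path_bracket y (basis_path k))) k = 0"
proof -
  assume "y \<in> cartan"
  then show "Poly_Mapping.lookup (path_bracket x (path_bracket y (basis_path k))) k = weight_diff k y * weight_diff k x"
    using x k lookup_path_bracket_long[OF x k]
    by (simp add: path_bracket_cartan_long long_paths_def path_bracket_scale)
next
  assume "y \<in> in_degree_ge 1"
  then have "path_bracket x (path_bracket y (basis_path k)) \<in> in_degree_ge (0 + (1 + path_length k))"
    by (intro path_bracket_degree) auto
  then show "Poly_Mapping.lookup (path_bracket x (path_bracket y (basis_path k))) k = 0"
    by (rule lookup_eq_0_if_degree) simp
qed

context
  fixes A assumes A: "metric.orthonormal A" "span A = cartan"
begin

abbreviation "frame \<equiv> A \<union> unit_path ` long_paths"

text \<open>Frame vectors in \<open>cartan\<close> contribute nothing, being orthogonal to all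
  brackets; each path contributes its weight.\<close>

lemma trace_ad:
  assumes "z \<in> path_algebra Q"
  shows "(\<Sum>e\<in>frame. path_ip (path_bracket z e) e) = (\<Sum>k\<in>long_paths. weight_diff k z)"
proof -
  have "path_ip (path_bracket z a) a = 0" if "a \<in> A" for a
    using assms A_mem[OF A that] A_cartan[OF A that]
    by (intro path_ip_degree_cartan path_bracket_in_degree_1)
  moreover have "path_ip (path_bracket z (unit_path k)) (unit_path k) = weight_diff k z" if "k \<in> long_paths" for k
    using that lookup_path_bracket_long[OF assms that] path_norm_pos[of k]
    by (simp add: path_ip_unit_path) (simp add: unit_path_def path_bracket_scale)
  ultimately show ?thesis by (simp add: sum_orthonormal_basis[OF A])
qed

lemma trace_ad_ad:
  assumes x: "x \<in> path_algebra Q" and y: "y \<in> path_algebra Q"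
  shows "(\<Sum>e\<in>frame. path_ip (path_bracket x (path_bracket y e)) e) =
    (\<Sum>k\<in>long_paths. Poly_Mapping.lookup (path_bracket x (path_bracket y (basis_path k))) k)"
proof -
  have "path_ip (path_bracket x (path_bracket y a)) a = 0" if "a \<in> A" for a
    using x y A_mem[OF A that] A_cartan[OF A that]
    by (intro path_ip_degree_cartan path_bracket_in_degree_1 path_bracket_in_path_algebra)
  moreover have "path_ip (path_bracket x (path_bracket y (unit_path k))) (unit_path k)
      = Poly_Mapping.lookup (path_bracket x (path_bracket y (basis_path k))) k" if "k \<in> long_paths" for k
    using that path_norm_pos[of k]
    by (simp add: path_ip_unit_path) (simp add: unit_path_def path_bracket_scale)
  ultimately show ?thesis by (simp add: sum_orthonormal_basis[OF A])
qed

text \<open>The trace of ad vanishes on paths of positive length, so \<open>H\<close> is orthogonal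
  to all of them. Nothing more explicit about \<open>H\<close> enters: its weights are additive
  along paths and are absorbed into the derivation.\<close>

lemma mean_curvature_cartan:
  assumes H: "H \<in> path_algebra Q" "\<And>z. z \<in> path_algebra Q \<Longrightarrow> path_ip H z = (\<Sum>k\<in>long_paths. weight_diff k z)"
  shows "H \<in> cartan"
proof -
  have "Poly_Mapping.lookup H p = 0" if p: "p \<in> long_paths" for p
  proof -
    have "path_ip H (basis_path p) = (\<Sum>k\<in>long_paths. weight_diff k (basis_path p))"
      using H(2) p long_path_mem by blast
    also have "\<dots> = 0"
      using p long_path_length by (intro sum.neutral ballI weight_diff_eq_0_if_degree) simp
    finally show ?thesis using p path_norm_pos[of p] by (simp add: path_ip_long)
  qed
  then show ?thesis
    using H(1) unfolding span_basis_path path_algebra_def quiver_paths_eq by (auto simp: in_keys_iff)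
qed

context
  fixes H assumes H: "H \<in> path_algebra Q"
    "\<And>z. z \<in> path_algebra Q \<Longrightarrow> path_ip H z = (\<Sum>k\<in>long_paths. weight_diff k z)"
begin

lemma ricci_form_path_algebra:
  assumes "x \<in> path_algebra Q" "y \<in> path_algebra Q"
  shows "metric.ricci_form x y =
    (\<Sum>e\<in>frame. \<Sum>f\<in>frame. path_ip (path_bracket e f) x * path_ip (path_bracket e f) y) / 4
    - (\<Sum>e\<in>frame. path_ip (path_bracket x e) (path_bracket y e)) / 2
    - (\<Sum>k\<in>long_paths. Poly_Mapping.lookup (path_bracket x (path_bracket y (basis_path k))) k) / 2
    - (path_ip (path_bracket H x) y + path_ip (path_bracket H y) x) / 2"
  using metric.ricci_form_eq[OF orthonormal_basis[OF A] assms H(1)] H(2) trace_ad trace_ad_ad[OF assms]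
  by simp

lemma basis_mem: "e \<in> frame \<Longrightarrow> e \<in> path_algebra Q"
  using A_mem[OF A] unit_path_mem by auto

lemma path_ip_bracket_basis_cartan:
  assumes "e \<in> frame" "f \<in> frame" "x \<in> cartan"
  shows "path_ip (path_bracket e f) x = 0"
  using assms by (intro path_ip_degree_cartan path_bracket_in_degree_1 basis_mem)

text \<open>The first sum vanishes because brackets are orthogonal to \<open>cartan\<close>, and
  \<open>H\<close> commutes with both arguments. The two middle sums are equal and add up to minus
  the sum of weight products, which the factor 2 in \<open>path_ip\<close> converts into the
  coefficient -1/2.\<close>

lemma ricci_form_cartan:
  assumes x: "x \<in> cartan" and y: "y \<in> cartan"
  shows "metric.ricci_form x y = - (path_ip x y - vertex_sum x * vertex_sum y) / 2"
proof -
  have xy: "x \<in> path_algebra Q" "y \<in> path_algebra Q" using x y cartan_subset by auto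
  have "(\<Sum>e\<in>frame. \<Sum>f\<in>frame. path_ip (path_bracket e f) x * path_ip (path_bracket e f) y) = 0"
    by (intro sum.neutral ballI) (simp only: path_ip_bracket_basis_cartan[OF _ _ x] mult_zero_left)
  moreover have "(\<Sum>e\<in>frame. path_ip (path_bracket x e) (path_bracket y e))
      = (\<Sum>k\<in>long_paths. weight_diff k x * weight_diff k y)"
  proof -
    have "path_ip (path_bracket x (unit_path k)) (path_bracket y (unit_path k)) = weight_diff k x * weight_diff k y"
      if k: "k \<in> long_paths" for k
    proof -
      have "k \<in> quiver_paths Q" using k by (simp add: long_paths_def)
      then show ?thesis
        using k x y path_norm_pos[of k]
        by (simp add: path_ip_unit_bracket path_bracket_cartan_long path_ip_scale path_ip_long_long)
    qed
    then show ?thesis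
      using x A_cartan[OF A] by (simp add: sum_orthonormal_basis[OF A] path_bracket_cartan)
  qed
  moreover have "(\<Sum>k\<in>long_paths. Poly_Mapping.lookup (path_bracket x (path_bracket y (basis_path k))) k)
      = (\<Sum>k\<in>long_paths. weight_diff k x * weight_diff k y)"
    using lookup_path_bracket_bracket(1)[OF xy(1) _ y] by (simp add: mult.commute)
  moreover have "path_bracket H x = 0" "path_bracket H y = 0"
    using mean_curvature_cartan[OF H] x y by (simp_all add: path_bracket_cartan)
  moreover have "path_ip x y = 2 * (\<Sum>k\<in>long_paths. weight_diff k x * weight_diff k y) + vertex_sum x * vertex_sum y"
    using x by (simp add: path_ip_def lookup_cartan)
  ultimately show ?thesis
    using ricci_form_path_algebra[OF xy] by simp
qed

text \<open>Bracketing with \<open>x\<close> rescales a path \<open>k\<close>, while bracketing with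
  \<open>p\<close> never returns a multiple of \<open>k\<close>, so the two images are orthogonal.
  The other terms vanish by degree.\<close>

lemma ricci_form_cartan_long:
  assumes x: "x \<in> cartan" and p: "p \<in> long_paths"
  shows "metric.ricci_form x (basis_path p) = 0" "metric.ricci_form (basis_path p) x = 0"
proof -
  have mem: "x \<in> path_algebra Q" "basis_path p \<in> path_algebra Q"
    using x cartan_subset p long_path_mem by auto
  have deg: "basis_path p \<in> in_degree_ge 1" using p long_path_length by simp
  note zero = path_ip_bracket_basis_cartan[OF _ _ x]
  have H_zero: "path_bracket H x = 0"
    using mean_curvature_cartan[OF H] x by (rule path_bracket_cartan)
  have H_zero': "path_ip (path_bracket H (basis_path p)) x = 0"
    using x H(1) mem by (intro path_ip_degree_cartan path_bracket_in_degree_1)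
  have "path_ip (path_bracket x (unit_path k)) (path_bracket (basis_path p) (unit_path k)) = 0"
    if k: "k \<in> long_paths" for k
  proof -
    have "path_bracket x (basis_path k) = weight_diff k x *\<^sub>R basis_path k"
      using k x by (simp add: path_bracket_cartan_long long_paths_def)
    moreover have "path_ip (basis_path k) (path_bracket (basis_path p) (basis_path k)) = 0"
      using k lookup_path_bracket_long[OF mem(2) k] weight_diff_eq_0_if_degree[OF deg]
        path_ip_commute[of "basis_path k"] by (simp add: path_ip_long)
    ultimately show ?thesis by (simp add: path_ip_unit_bracket path_ip_scale)
  qed
  then have sum_zero: "(\<Sum>e\<in>frame. path_ip (path_bracket x e) (path_bracket (basis_path p) e)) = 0"
    using x A_cartan[OF A] by (simp add: sum_orthonormal_basis[OF A] path_bracket_cartan)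
  have "(\<Sum>e\<in>frame. path_ip (path_bracket (basis_path p) e) (path_bracket x e))
      = (\<Sum>e\<in>frame. path_ip (path_bracket x e) (path_bracket (basis_path p) e))"
    by (intro sum.cong refl) (rule path_ip_commute)
  with sum_zero have sum_zero': "(\<Sum>e\<in>frame. path_ip (path_bracket (basis_path p) e) (path_bracket x e)) = 0"
    by simp
  show "metric.ricci_form x (basis_path p) = 0"
    using zero H_zero H_zero' sum_zero lookup_path_bracket_bracket(2)[OF mem(1) _ deg]
    by (simp add: ricci_form_path_algebra[OF mem])
  show "metric.ricci_form (basis_path p) x = 0"
    using zero H_zero H_zero' sum_zero' lookup_path_bracket_bracket(1)[OF mem(2) _ x] weight_diff_eq_0_if_degree[OF deg]
    by (simp add: ricci_form_path_algebra[OF mem(2,1)])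
qed

text \<open>Splittings of \<open>p\<close> produce the interior weights, extensions of
  \<open>p\<close> at its two ends produce the counts, and \<open>H\<close> produces the weight. The
  contributions of the frame of \<open>cartan\<close> cancel.\<close>

lemma ricci_form_long:
  assumes p: "p \<in> long_paths" and q: "q \<in> long_paths"
  shows "metric.ricci_form (basis_path p) (basis_path q) = (if p = q then path_norm p *
    ((sum_list (map vertex_weight (interior p)) - vertex_weight (target p) * out_count (target p)
      - vertex_weight (source p) * in_count (source p)) / 2 - weight_diff p H) else 0)"
proof -
  have mem: "basis_path p \<in> path_algebra Q" "basis_path q \<in> path_algebra Q"
    using p q long_path_mem by auto
  have deg: "basis_path q \<in> in_degree_ge 1" using q long_path_length by simp
  \<comment> \<open>Squared length of the weight of \<open>p\<close> as a functional on
    \<open>cartan\<close>. It enters \<open>T1 / 4\<close> and \<open>T2 / 2\<close> equally and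
    drops out.\<close>
  let ?\<theta> = "\<Sum>a\<in>A. weight_diff p a * weight_diff p a"
  let ?t = "\<lambda>e f. path_ip (path_bracket e f) (basis_path p) * path_ip (path_bracket e f) (basis_path q)"
  let ?pq = "if p = q then 1 else 0 :: real"
  have AA: "?t a b = 0" if "a \<in> A" "b \<in> A" for a b
    using that A_cartan[OF A] by (simp add: path_bracket_cartan)
  have AU: "(\<Sum>k\<in>long_paths. ?t a (unit_path k)) = ?pq * path_norm p * (weight_diff p a * weight_diff p a)"
    if a: "a \<in> A" for a
  proof -
    have "?t a (unit_path k) = (if p = k then ?pq * path_norm p * (weight_diff p a * weight_diff p a) else 0)"
      if k: "k \<in> long_paths" for k
    proof -
      have "path_bracket a (basis_path k) = weight_diff k a *\<^sub>R basis_path k"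
        using k A_cartan[OF A a] by (simp add: path_bracket_cartan_long long_paths_def)
      then have "?t a (unit_path k) = (weight_diff k a * weight_diff k a) *
          (path_ip (basis_path k) (basis_path p) * path_ip (basis_path k) (basis_path q)) *
          (1 / sqrt (path_norm k) * (1 / sqrt (path_norm k)))"
        by (simp add: unit_path_def path_bracket_scale path_ip_scale)
      then show ?thesis
        unfolding inverse_sqrt_path_norm using p q k path_norm_pos[of p] by (simp add: path_ip_long_long)
    qed
    then show ?thesis using p finite_long_paths by (simp add: sum.delta)
  qed
  \<comment> \<open>The sign of the swapped bracket occurs twice; mixed pairs of frame vectors
    therefore count double in \<open>T1\<close>.\<close>
  have UA: "?t (unit_path k) a = ?t a (unit_path k)" for a k
    using path_bracket_anticommute[of "unit_path k" a] by (simp add: path_ip_minus)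
  have UU: "(\<Sum>k\<in>long_paths. \<Sum>l\<in>long_paths. ?t (unit_path k) (unit_path l))
      = ?pq * (2 * path_norm p * sum_list (map vertex_weight (interior p)))"
  proof -
    have "(\<Sum>k\<in>long_paths. \<Sum>l\<in>long_paths. ?t (unit_path k) (unit_path l)) =
      (\<Sum>k\<in>long_paths. \<Sum>l\<in>long_paths. path_norm p * path_norm q *
        (Poly_Mapping.lookup (path_bracket (basis_path k) (basis_path l)) p *
         Poly_Mapping.lookup (path_bracket (basis_path k) (basis_path l)) q / (path_norm k * path_norm l)))"
    proof (intro sum.cong refl)
      fix k l
      have "?t (unit_path k) (unit_path l) = path_norm p * path_norm q *
        (Poly_Mapping.lookup (path_bracket (unit_path k) (unit_path l)) p *
         Poly_Mapping.lookup (path_bracket (unit_path k) (unit_path l)) q)"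
        using p q by (simp add: path_ip_long)
      then show "?t (unit_path k) (unit_path l) = path_norm p * path_norm q *
        (Poly_Mapping.lookup (path_bracket (basis_path k) (basis_path l)) p *
         Poly_Mapping.lookup (path_bracket (basis_path k) (basis_path l)) q / (path_norm k * path_norm l))"
        unfolding lookup_unit_unit_bracket .
    qed
    also have "\<dots> = path_norm p * path_norm q *
        (if p = q then 2 * sum_list (map vertex_weight (interior p)) / path_norm p else 0)"
      unfolding sum_lookup_path_bracket_long[OF p, symmetric] by (simp only: sum_distrib_left)
    finally show ?thesis using path_norm_pos[of p] by (cases "p = q") simp_all
  qed
  have T1: "(\<Sum>e\<in>frame. \<Sum>f\<in>frame. ?t e f) =
      ?pq * (2 * path_norm p * ?\<theta> + 2 * path_norm p * sum_list (map vertex_weight (interior p)))"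
  proof -
    have "(\<Sum>e\<in>frame. \<Sum>f\<in>frame. ?t e f) =
      (\<Sum>a\<in>A. (\<Sum>b\<in>A. ?t a b) + (\<Sum>k\<in>long_paths. ?t a (unit_path k))) +
      (\<Sum>k\<in>long_paths. (\<Sum>a\<in>A. ?t (unit_path k) a) + (\<Sum>l\<in>long_paths. ?t (unit_path k) (unit_path l)))"
      by (simp only: sum_orthonormal_basis[OF A])
    also have "\<dots> = (\<Sum>a\<in>A. \<Sum>k\<in>long_paths. ?t a (unit_path k)) +
      ((\<Sum>k\<in>long_paths. \<Sum>a\<in>A. ?t a (unit_path k)) +
        (\<Sum>k\<in>long_paths. \<Sum>l\<in>long_paths. ?t (unit_path k) (unit_path l)))"
    proof -
      have "(\<Sum>a\<in>A. \<Sum>b\<in>A. ?t a b) = 0" by (intro sum.neutral ballI AA)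
      moreover have "(\<Sum>k\<in>long_paths. \<Sum>a\<in>A. ?t (unit_path k) a)
          = (\<Sum>k\<in>long_paths. \<Sum>a\<in>A. ?t a (unit_path k))"
        by (intro sum.cong refl UA)
      ultimately show ?thesis by (simp only: sum.distrib add_0_left)
    qed
    also have "(\<Sum>k\<in>long_paths. \<Sum>a\<in>A. ?t a (unit_path k)) = (\<Sum>a\<in>A. \<Sum>k\<in>long_paths. ?t a (unit_path k))"
      by (rule sum.swap)
    also have "(\<Sum>a\<in>A. \<Sum>k\<in>long_paths. ?t a (unit_path k)) = ?pq * path_norm p * ?\<theta>"
      unfolding sum_distrib_left by (rule sum.cong[OF refl AU])
    finally show ?thesis unfolding UU by (simp add: algebra_simps)
  qed
  have T2: "(\<Sum>e\<in>frame. path_ip (path_bracket (basis_path p) e) (path_bracket (basis_path q) e)) =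
      ?pq * path_norm p * ?\<theta> + ?pq * path_norm p * (vertex_weight (target p) * out_count (target p)
        + vertex_weight (source p) * in_count (source p))"
  proof -
    have "path_ip (path_bracket (basis_path p) a) (path_bracket (basis_path q) a)
        = ?pq * path_norm p * (weight_diff p a * weight_diff p a)" if a: "a \<in> A" for a
    proof -
      have "path_bracket (basis_path r) a = - (weight_diff r a *\<^sub>R basis_path r)" if "r \<in> long_paths" for r
        using that A_cartan[OF A a] path_bracket_anticommute[of "basis_path r" a]
        by (simp add: path_bracket_cartan_long long_paths_def)
      then show ?thesis using p q by (simp add: path_ip_minus path_ip_scale path_ip_long_long)
    qed
    then show ?thesis
      using sum_path_ip_bracket_long[OF p q]
      by (simp add: sum_orthonormal_basis[OF A] path_ip_unit_bracket sum_distrib_left)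
  qed
  have T3: "(\<Sum>k\<in>long_paths. Poly_Mapping.lookup (path_bracket (basis_path p) (path_bracket (basis_path q) (basis_path k))) k) = 0"
    using lookup_path_bracket_bracket(2)[OF mem(1) _ deg] by simp
  have T4: "path_ip (path_bracket H (basis_path p)) (basis_path q) = ?pq * path_norm p * weight_diff p H"
    "path_ip (path_bracket H (basis_path q)) (basis_path p) = ?pq * path_norm p * weight_diff p H"
    using p q mean_curvature_cartan[OF H]
    by (simp_all add: path_bracket_cartan_long path_ip_scale path_ip_long_long long_paths_def)
  show ?thesis
    unfolding ricci_form_path_algebra[OF mem] T1 T2 T3 T4 by (simp add: field_simps)
qed

text \<open>One half plus the Ricci eigenvalue of the path of length 1.\<close>

definition arrow_weight :: "'e \<Rightarrow> real" where
  "arrow_weight a = (1 - vertex_weight (head Q a) * out_count (head Q a)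
      - vertex_weight (tail Q a) * in_count (tail Q a)) / 2
    - (Poly_Mapping.lookup H (vertex_path (tail Q a)) - Poly_Mapping.lookup H (vertex_path (head Q a)))"

text \<open>For one arrow the interior is empty and this is the definition. Prepending an arrow lets
  the \<open>H\<close> terms telescope and leaves a balance at the new interior vertex.\<close>

lemma arrow_sum_arrow_weight:
  assumes "p \<in> long_paths"
  shows "arrow_sum arrow_weight p = 1 / 2 + ((sum_list (map vertex_weight (interior p))
      - vertex_weight (target p) * out_count (target p)
      - vertex_weight (source p) * in_count (source p)) / 2 - weight_diff p H)"
proof -
  have "sum_list (map arrow_weight as) = 1 / 2 + ((sum_list (map vertex_weight (map (head Q) (butlast as)))
      - vertex_weight v * out_count v - vertex_weight u * in_count u) / 2
      - (Poly_Mapping.lookup H (vertex_path u) - Poly_Mapping.lookup H (vertex_path v)))"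
    if "awalk u as v" "as \<noteq> []" for u as v
    using that
  proof (induction as arbitrary: u)
    case (Cons a as)
    then have a: "u = tail Q a" "awalk (head Q a) as v" by (auto simp: awalk_Cons_iff)
    show ?case
    proof (cases "as = []")
      case True
      then have "v = head Q a" using a by (simp add: awalk_Nil_iff)
      then show ?thesis using True a by (simp add: arrow_weight_def field_simps)
    next
      case False
      let ?m = "head Q a"
      \<comment> \<open>At \<open>?m\<close> the two arrow weights leave \<open>1/2\<close> minus
        half the out and in terms, which by this identity is half of
        \<open>vertex_weight ?m\<close>, the new interior summand.\<close>
      have "vertex_weight ?m * (1 + out_count ?m + in_count ?m) = 1"
        by (simp add: vertex_weight_def add_nonneg_eq_0_iff)
      then have "vertex_weight ?m + vertex_weight ?m * out_count ?m + vertex_weight ?m * in_count ?m = 1"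
        by (simp add: algebra_simps)
      then show ?thesis
        using False a Cons.IH[OF a(2) False] by (simp add: arrow_weight_def field_simps)
    qed
  qed simp
  then show ?thesis
    using assms by (cases p) (auto simp: long_paths_def quiver_paths_def arrow_sum_def interior_def weight_diff_def)
qed

text \<open>Both sides are bilinear on the path algebra, so pairs of paths decide; the reduction
  treats one argument at a time.\<close>

lemma ricci_form_soliton:
  assumes "x \<in> path_algebra Q" "y \<in> path_algebra Q"
  shows "metric.ricci_form x y = path_ip ((- 1 / 2) *\<^sub>R x + soliton_derivation arrow_weight x) y"
proof -
  let ?S = "\<lambda>x. (- 1 / 2) *\<^sub>R x + soliton_derivation arrow_weight x"
  have linS: "linear ?S"
    by (intro linear_compose_add linear_soliton_derivation linear_scale_self)
  have vert: "?S x = (- 1 / 2) *\<^sub>R x + (vertex_sum x / (2 * card (verts Q))) *\<^sub>R identity" if "x \<in> cartan" for x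
  proof -
    have "diagonal arrow_weight x = 0"
    proof (rule linear_eq_on[OF linear_diagonal linear_zero that])
      fix b :: "('v, 'e) qpath \<Rightarrow>\<^sub>0 real"
      assume "b \<in> basis_path ` vertex_path ` verts Q"
      then show "diagonal arrow_weight b = 0"
        by (auto simp: diagonal_basis_path quiver_paths_eq arrow_sum_def)
    qed
    then show ?thesis by (simp add: soliton_derivation_def)
  qed
  have long: "?S (basis_path p) = (arrow_sum arrow_weight p - 1 / 2) *\<^sub>R basis_path p" if "p \<in> long_paths" for p
  proof -
    have "vertex_sum (basis_path p) = 0"
      using that long_path_length by (intro vertex_sum_eq_0_if_degree) simp
    then show ?thesis
      using that by (simp add: soliton_derivation_def diagonal_basis_path long_paths_def algebra_simps)
  qed
  have vertex_cartan: "basis_path (vertex_path v) \<in> cartan" if "v \<in> verts Q" for v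
    using that by (intro span_base) auto
  have card: "card (verts Q) \<noteq> 0" using verts_nonempty by simp
  have basis: "metric.ricci_form (basis_path k) (basis_path l) = path_ip (?S (basis_path k)) (basis_path l)"
    if "k \<in> quiver_paths Q" "l \<in> quiver_paths Q" for k l
  proof -
    consider "k \<in> long_paths" "l \<in> long_paths"
      | "k \<in> long_paths" "basis_path l \<in> cartan"
      | "basis_path k \<in> cartan" "l \<in> long_paths"
      | "basis_path k \<in> cartan" "basis_path l \<in> cartan"
      using \<open>k \<in> quiver_paths Q\<close> \<open>l \<in> quiver_paths Q\<close> vertex_cartan unfolding quiver_paths_eq by blast
    then show ?thesis
    proof cases
      case 1
      then show ?thesis
        unfolding long[OF 1(1)]
        by (simp add: path_ip_scale path_ip_long_long ricci_form_long arrow_sum_arrow_weight)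
    next
      case 2
      have "path_ip (basis_path k) (basis_path l) = 0"
        using 2 long_path_length by (intro path_ip_degree_cartan) simp_all
      then show ?thesis
        unfolding long[OF 2(1)] using 2 by (simp add: path_ip_scale ricci_form_cartan_long)
    next
      case 3
      \<comment> \<open>\<open>identity\<close> is a combination of vertices, so the central
        correction does not leave \<open>cartan\<close> and stays orthogonal to longer
        paths.\<close>
      have "?S (basis_path k) \<in> cartan"
        unfolding vert[OF 3(1)] using 3(1) identity_in_cartan by (intro span_add span_scale)
      then show ?thesis using 3 by (simp add: path_ip_long lookup_cartan ricci_form_cartan_long)
    next
      case 4
      \<comment> \<open>Pairing with \<open>identity\<close> gives \<open>card (verts Q)\<close>
        times \<open>vertex_sum\<close>; what remains is half the product of the vertex sums,
        exactly the defect in \<open>ricci_form_cartan\<close>.\<close>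
      have "path_ip (?S (basis_path k)) (basis_path l) = - 1 / 2 * path_ip (basis_path k) (basis_path l)
          + vertex_sum (basis_path k) / (2 * card (verts Q)) * path_ip identity (basis_path l)"
        unfolding vert[OF 4(1)] by (simp only: path_ip_add_left path_ip_scale)
      then show ?thesis using 4 card by (simp add: ricci_form_cartan path_ip_identity field_simps)
    qed
  qed
  note bil = metric.bilinear_ricci_form[unfolded bilinear_within_def]
  have 1: "metric.ricci_form x (basis_path l) = path_ip (?S x) (basis_path l)" if l: "l \<in> quiver_paths Q" for l
  proof (rule linear_within_eq_on_span[where f = "\<lambda>x. metric.ricci_form x (basis_path l)"
        and B = "basis_path ` quiver_paths Q"])
    show "linear_within (span (basis_path ` quiver_paths Q)) (\<lambda>x. metric.ricci_form x (basis_path l))"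
      using bil basis_path_mem[OF l] unfolding path_algebra_eq_span by blast
    have "linear (\<lambda>x. path_ip (basis_path l) (?S x))"
      using linear_compose[OF linS linear_path_ip[of "basis_path l"]] by (simp add: o_def)
    then show "linear_within (span (basis_path ` quiver_paths Q)) (\<lambda>x. path_ip (?S x) (basis_path l))"
      by (intro linear_within_if_linear) (simp add: path_ip_commute[of "basis_path l"])
  qed (use assms(1) basis[OF _ l] in \<open>auto simp: path_algebra_eq_span\<close>)
  show ?thesis
  proof (rule linear_within_eq_on_span[where f = "metric.ricci_form x" and B = "basis_path ` quiver_paths Q"])
    show "linear_within (span (basis_path ` quiver_paths Q)) (metric.ricci_form x)"
      using bil assms(1) unfolding path_algebra_eq_span by blast
    show "linear_within (span (basis_path ` quiver_paths Q)) (path_ip (?S x))"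
      by (intro linear_within_if_linear linear_path_ip)
  qed (use assms(2) 1 in \<open>auto simp: path_algebra_eq_span\<close>)
qed

end

end

lemma algebraic_ricci_soliton_path_algebra: "algebraic_ricci_soliton (path_algebra Q) path_bracket path_ip"
proof
  obtain A where A: "metric.orthonormal A" "span A = cartan" using ex_cartan_basis by blast
  have "linear (\<lambda>z. \<Sum>k\<in>long_paths. weight_diff k z)"
    by (intro linear_compose_sum ballI linear_weight_diff)
  \<comment> \<open>The mean curvature vector: it represents the functional sending \<open>z\<close>
    to the trace of ad z.\<close>
  then obtain H where H: "H \<in> path_algebra Q"
      "\<And>z. z \<in> path_algebra Q \<Longrightarrow> path_ip H z = (\<Sum>k\<in>long_paths. weight_diff k z)"
    using metric.ip_representation[OF linear_within_if_linear] by metis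
  let ?D = "soliton_derivation (arrow_weight H)"
  have "metric.ricci x = (- 1 / 2) *\<^sub>R x + ?D x" if "x \<in> path_algebra Q" for x
    using that ricci_form_soliton[OF A H] soliton_derivation_mem
    by (intro metric.ricci_eqI subspace_add[OF subspace_path_algebra] subspace_scale[OF subspace_path_algebra])
  then show "\<exists>c D. metric.derivation D \<and> (\<forall>x\<in>path_algebra Q. metric.ricci x = c *\<^sub>R x + D x)"
    using derivation_soliton_derivation by blast
qed

end

theorem theorem3p12:
  fixes Q :: "('v, 'e) pre_digraph"
  assumes "fin_digraph Q" and "weakly_connected Q" and "quiver_acyclic Q"
  shows "\<exists>ip. algebraic_ricci_soliton (path_algebra Q) path_bracket ip"
proof -
  interpret acyclic_quiver Q
    using assms unfolding acyclic_quiver_def acyclic_quiver_axioms_def by blast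
  show ?thesis using algebraic_ricci_soliton_path_algebra by blast
qed

end
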